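(* Let $P$ be a 3-colorable convex polytope with $2n$ vertices, with a fixed proper coloring of its faces by $1,2,3$, let $m_i$ be the number of faces colored by $i$, and let $\widetilde P$ be the convex hull of the face-vertex incident vectors of $P$, with vertex set $S=V_1\cup V_2\cup V_3$. Suppose $m_3=m_2=m_1\geq 2$. Then a Gale diagram of $\widetilde P$ lies on the unit circle in $\mathbb{R}^2$ and consists of the point $\left(\tfrac{1}{\sqrt2},\tfrac{1}{\sqrt2}\right)$ with multiplicity $m_1$, the point $(-1,0)$ with multiplicity $m_2$, and the point $(0,-1)$ with multiplicity $m_3$. Moreover: (1) for $J\subsetneq S$, $\operatorname{conv}(J)$ is a proper face of $\widetilde P$ if and only if $V_i\not\subseteq J$ for $i=1,2,3$; (2) $\widetilde P$ is a simplicial convex polytope and is $(m_2-1)$-neighborly; (3) $\widetilde P$ is the convex hull of a point $w$ and a convex $(n-1)$-polytope $Q$, where $Q$ is (combinatorially) an $(m_2-1)$-fold $(n-1)$-pyramid with basis $C(2m_2,2m_2-2)$, and the facets of $Q$ that $w$ is beyond are exactly the non-simplex facets of $Q$, of which there are $m_2-1$.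
   Context: A convex polytope $P$ is 3-colorable if it is 3-dimensional and simple (each vertex belongs to exactly three 2-dimensional faces) and each facet can be assigned a color in $\{1,2,3\}$ so that adjacent facets have different colors. "Face of $P$" means 2-dimensional face. Such a $P$ has an even number $2n$ of vertices and $n+2$ faces. Identify the vertex set of $P$ with $\{1,\dots,2n\}$. For a face $f$ of $P$, $\xi_f\in\{0,1\}^{2n}\subseteq\mathbb{R}^{2n}$ (the face-vertex incident vector) has entry $1$ at $v$ if $v\in f$ and $0$ otherwise. Let $S=\{\xi_f: f\text{ a face of }P\}$, $\widetilde P=\operatorname{conv}(S)$. The vertex set of $\widetilde P$ is exactly $S$, of size $n+2$. Put $V_i=\{\xi_f: f\text{ is colored by }i\}$, so $|V_i|=m_i$. Gale transform/diagram: for a list $v_1,\dots,v_N$ of column vectors in a Euclidean space with $d=\dim\operatorname{conv}\{v_1,\dots,v_N\}$, choose a basis $\beta_1,\dots,\beta_{N-d-1}$ of the null space of the matrix $\begin{bmatrix}1&\cdots&1\\ v_1&\cdots&v_N\end{bmatrix}$ and let $\bar v_j\in\mathbb{R}^{N-d-1}$ be the $j$-th row of $[\beta_1,\dots,\beta_{N-d-1}]$. The multiset $\{\bar v_j\}$ is a Gale transform. Replacing each nonzero $\bar v_j$ by $\bar v_j/\|\bar v_j\|$ (and leaving zero vectors as $0$) gives a Gale diagram. A Gale diagram of a polytope is one of its vertex set. A proper face is a face different from the whole polytope (the empty face is allowed). A polytope is simplicial if all its proper faces are simplices; it is $k$-neighborly if every set of $k$ of its vertices is exactly the vertex set of a proper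 face. A $d$-pyramid with basis $K$ is the convex hull of a $(d-1)$-polytope $K$ and a point (apex) outside the affine hull of $K$. A $0$-fold pyramid with basis $K$ is $K$ itself, and an $r$-fold $d$-pyramid with basis $K$ is a $d$-pyramid whose basis is an $(r-1)$-fold $(d-1)$-pyramid with basis $K$; "combinatorially" means up to isomorphism of face lattices. $C(v,d)$ is the cyclic $d$-polytope with $v$ vertices (convex hull of $v$ distinct points on the moment curve in $\mathbb{R}^d$). A point $w$ in the affine hull of a polytope $Q$ is beyond a facet $F$ of $Q$ if the affine span of $F$ (a hyperplane in the affine hull of $Q$) strictly separates $w$ from the relative interior of $Q$. *)

theory Defs
  imports "HOL-Analysis.Analysis" "HOL-Library.Multiset"
begin

definition vertices :: "'a::euclidean_space set \<Rightarrow> 'a set" where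
  "vertices K = {x. x extreme_point_of K}"

definition proper_face_of :: "'a::euclidean_space set \<Rightarrow> 'a set \<Rightarrow> bool" (infix \<open>proper'_face'_of\<close> 50) where
  "F proper_face_of K \<longleftrightarrow> F face_of K \<and> F \<noteq> K"

definition two_faces :: "'a::euclidean_space set \<Rightarrow> 'a set set" where
  "two_faces P = {F. F face_of P \<and> aff_dim F = 2}"

definition simple_3_polytope :: "'a::euclidean_space set \<Rightarrow> bool" where
  "simple_3_polytope P \<longleftrightarrow> polytope P \<and> aff_dim P = 3 \<and>
     (\<forall>x\<in>vertices P. card {F \<in> two_faces P. x \<in> F} = 3)"

text \<open>Two distinct facets of a 3-polytope are adjacent if they share an edge.\<close>

definition proper_coloring :: "'a::euclidean_space set \<Rightarrow> ('a set \<Rightarrow> nat) \<Rightarrow> bool" where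
  "proper_coloring P c \<longleftrightarrow>
     (\<forall>F\<in>two_faces P. c F \<in> {1, 2, 3}) \<and>
     (\<forall>F\<in>two_faces P. \<forall>G\<in>two_faces P. F \<noteq> G \<and> aff_dim (F \<inter> G) = 1 \<longrightarrow> c F \<noteq> c G)"

definition three_colorable :: "'a::euclidean_space set \<Rightarrow> bool" where
  "three_colorable P \<longleftrightarrow> simple_3_polytope P \<and> (\<exists>c. proper_coloring P c)"

definition color_count :: "'a::euclidean_space set \<Rightarrow> ('a set \<Rightarrow> nat) \<Rightarrow> nat \<Rightarrow> nat" where
  "color_count P c i = card {F \<in> two_faces P. c F = i}"

text \<open>In the following, \<open>lab\<close> is a bijection from the index type \<open>'v\<close> onto the vertex set
  of the 3-polytope, so that \<open>real ^ 'v\<close> plays the role of $R^{2n}$.\<close>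

definition face_vector :: "('v \<Rightarrow> 'a) \<Rightarrow> 'a set \<Rightarrow> real ^ 'v" where
  "face_vector lab F = (\<chi> i. if lab i \<in> F then 1 else 0)"

definition face_vectors :: "'a::euclidean_space set \<Rightarrow> ('v::finite \<Rightarrow> 'a) \<Rightarrow> (real ^ 'v) set" where
  "face_vectors P lab = face_vector lab ` two_faces P"

definition color_vectors ::
    "'a::euclidean_space set \<Rightarrow> ('v::finite \<Rightarrow> 'a) \<Rightarrow> ('a set \<Rightarrow> nat) \<Rightarrow> nat \<Rightarrow> (real ^ 'v) set" where
  "color_vectors P lab c i = face_vector lab ` {F \<in> two_faces P. c F = i}"

definition face_vector_polytope :: "'a::euclidean_space set \<Rightarrow> ('v::finite \<Rightarrow> 'a) \<Rightarrow> (real ^ 'v) set" where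
  "face_vector_polytope P lab = convex hull (face_vectors P lab)"

text \<open>The null space of the matrix with columns $(1, v_j)$. Only the values \<open>a j\<close> with
  \<open>j < length vs\<close> matter, i.e. \<open>a\<close> stands for a vector of length \<open>length vs\<close>.\<close>

definition affine_relation :: "'b::euclidean_space list \<Rightarrow> (nat \<Rightarrow> real) \<Rightarrow> bool" where
  "affine_relation vs a \<longleftrightarrow>
     (\<Sum>j<length vs. a j) = 0 \<and> (\<Sum>j<length vs. a j *\<^sub>R vs ! j) = 0"

text \<open>\<open>gs\<close> is the list of rows of a matrix whose columns \<open>\<lambda>j. gs ! j $ k\<close> form a basis of
  that null space: they lie in it, are linearly independent, and span it.\<close>

definition gale_transform :: "'b::euclidean_space list \<Rightarrow> (real ^ 'k) list \<Rightarrow> bool" where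
  "gale_transform vs gs \<longleftrightarrow>
     length gs = length vs \<and>
     int CARD('k) = int (length vs) - aff_dim (convex hull (set vs)) - 1 \<and>
     (\<forall>k. affine_relation vs (\<lambda>j. gs ! j $ k)) \<and>
     (\<forall>t. (\<forall>j<length vs. (\<Sum>k\<in>UNIV. t k * gs ! j $ k) = 0) \<longrightarrow> (\<forall>k. t k = 0)) \<and>
     (\<forall>a. affine_relation vs a \<longrightarrow>
        (\<exists>t. \<forall>j<length vs. a j = (\<Sum>k\<in>UNIV. t k * gs ! j $ k)))"

text \<open>\<open>sgn x\<close> is \<open>x /\<^sub>R norm x\<close> for nonzero vectors, and \<open>sgn 0 = 0\<close>.\<close>

definition gale_diagram_of :: "'b::euclidean_space set \<Rightarrow> (real ^ 'k) multiset \<Rightarrow> bool" where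
  "gale_diagram_of K D \<longleftrightarrow>
     (\<exists>vs gs. distinct vs \<and> set vs = vertices K \<and> gale_transform vs gs \<and> D = mset (map sgn gs))"

definition is_simplex :: "'a::euclidean_space set \<Rightarrow> bool" where
  "is_simplex F \<longleftrightarrow> (\<exists>k. k simplex F)"

definition simplicial_polytope :: "'a::euclidean_space set \<Rightarrow> bool" where
  "simplicial_polytope K \<longleftrightarrow> polytope K \<and> (\<forall>F. F proper_face_of K \<longrightarrow> is_simplex F)"

definition neighborly :: "nat \<Rightarrow> 'a::euclidean_space set \<Rightarrow> bool" where
  "neighborly k K \<longleftrightarrow> polytope K \<and>
     (\<forall>T. T \<subseteq> vertices K \<and> card T = k \<longrightarrow> (\<exists>F. F proper_face_of K \<and> vertices F = T))"

definition pyramid :: "int \<Rightarrow> 'a::euclidean_space set \<Rightarrow> 'a set \<Rightarrow> bool" where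
  "pyramid d K R \<longleftrightarrow> polytope K \<and> aff_dim K = d - 1 \<and>
     (\<exists>a. a \<notin> affine hull K \<and> R = convex hull (insert a K))"

text \<open>\<open>fold_pyramid r d K R\<close>: \<open>R\<close> is an \<open>r\<close>-fold \<open>d\<close>-pyramid with basis \<open>K\<close>.\<close>

fun fold_pyramid :: "nat \<Rightarrow> int \<Rightarrow> 'a::euclidean_space set \<Rightarrow> 'a set \<Rightarrow> bool" where
  "fold_pyramid 0 d K R \<longleftrightarrow> polytope K \<and> aff_dim K = d \<and> R = K"
| "fold_pyramid (Suc r) d K R \<longleftrightarrow> (\<exists>B. fold_pyramid r (d - 1) K B \<and> pyramid d B R)"

text \<open>The dimension \<open>d\<close> is a number rather than a type, so $R^d$ is taken to be the span of
  \<open>d\<close> distinct standard basis vectors \<open>e 0, \<dots>, e (d - 1)\<close> of the ambient space; the moment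
  curve is $t \mapsto (t, t^2, \dots, t^d)$ in these coordinates.\<close>

definition cyclic_polytope :: "nat \<Rightarrow> nat \<Rightarrow> 'a::euclidean_space set \<Rightarrow> bool" where
  "cyclic_polytope v d K \<longleftrightarrow>
     (\<exists>e T. inj_on e {..<d} \<and> e ` {..<d} \<subseteq> Basis \<and> finite T \<and> card T = v \<and>
        K = convex hull ((\<lambda>t::real. \<Sum>i<d. t ^ (i + 1) *\<^sub>R e i) ` T))"

text \<open>Isomorphism of face lattices.\<close>

definition comb_equiv :: "'a::euclidean_space set \<Rightarrow> 'b::euclidean_space set \<Rightarrow> bool" where
  "comb_equiv K L \<longleftrightarrow>
     (\<exists>\<phi>. bij_betw \<phi> {F. F face_of K} {G. G face_of L} \<and>
        (\<forall>F F'. F face_of K \<and> F' face_of K \<longrightarrow> (F \<subseteq> F' \<longleftrightarrow> \<phi> F \<subseteq> \<phi> F')))"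

definition beyond :: "'a::euclidean_space \<Rightarrow> 'a set \<Rightarrow> 'a set \<Rightarrow> bool" where
  "beyond w Q F \<longleftrightarrow> F facet_of Q \<and> w \<in> affine hull Q \<and>
     (\<exists>a b. affine hull F = affine hull Q \<inter> {x. a \<bullet> x = b} \<and>
        (\<forall>x\<in>rel_interior Q. a \<bullet> x < b) \<and> a \<bullet> w > b)"

end

theory Submission
  imports Defs "HOL-Computational_Algebra.Polynomial"
begin

text \<open>
  Everything follows from one fact about the face vectors: a linear combination of them vanishes
  only if its coefficients depend on the colour alone and the three values add up to zero
  (\<open>sum_star_eq_0_iff\<close>, \<open>sum_face_vector_eq_0_iff\<close>). Each vertex lies on one face of each colour, so a vanishing
  combination says that the three coefficients seen at any vertex add up to zero. The two ends of
  an edge share two faces, and their third faces have the same colour; hence the triple of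
  coefficients, indexed by colours, does not change along edges, and the graph of a polytope is
  connected. Conversely the face vectors of one colour always add up to the all-one vector.
  In other words, the vertex set of the polytope is the union of three classes \<open>V 1\<close>, \<open>V 2\<close>,
  \<open>V 3\<close> of size \<open>m\<close> whose only affine relations are the combinations of
  \<open>\<Sum>V 1 = \<Sum>V 2 = \<Sum>V 3\<close>. All claims except the dimension are consequences of this
  property (\<open>equal_sum_classes\<close>) and do not mention the 3-polytope any more.

  The passage from relations to faces is Gale's criterion (\<open>face_set_iff\<close>): \<open>J\<close> is the vertex
  set of a face if and only if no affine relation is nonnegative outside \<open>J\<close> and nonzero
  somewhere outside \<open>J\<close>. A relation with values \<open>\<alpha> 1 + \<alpha> 2 + \<alpha> 3 = 0\<close> on the classes can only
  be nonnegative on a set that meets all three classes if it is zero, so the proper faces come from the sets that contain no class. A set that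
  contains no class carries no relation, so proper faces are simplices, and sets with fewer
  than \<open>m\<close> elements are vertex sets of faces.

  The polytope \<open>Q\<close> is spanned by all vertices but one, \<open>w \<in> V 1\<close>. Relations on the remaining points vanish at \<open>w\<close>, hence on \<open>V 1\<close>, so they are
  the multiples of \<open>\<Sum>V 2 = \<Sum>V 3\<close>: the points form a set with a single circuit, with Radon
  partition \<open>V 2\<close>, \<open>V 3\<close> and with \<open>m - 1\<close> points outside the circuit. By Gale's criterion, the sizes of the three parts
  determine the face lattice (\<open>radon_comb_equiv\<close>). On the moment curve \<open>2 m\<close> points in
  dimension \<open>2 m - 2\<close> have a unique relation, and it alternates in sign; together with \<open>m - 1\<close>
  apexes in new coordinate directions it has the same three sizes, which identifies \<open>Q\<close>. A facet of
  \<open>Q\<close> is not a simplex exactly if it contains the circuit, that is, if it omits one apex \<open>v\<close>;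
  and \<open>w = \<Sum>V 2 - \<Sum>(V 1 - {w})\<close> lies on the side of that facet opposite to \<open>v\<close>.

  The dimension \<open>n - 1 = 3 m - 3\<close> needs \<open>3 m = n + 2\<close>, the case of Euler's formula for simple
  3-polytopes (\<open>card_two_faces\<close>). It is obtained by counting, for a linear functional that is
  injective on the vertices, the faces by their lowest and by their highest vertex. At a simple
  vertex both counts are read off from the three neighbours, because the polytope lies in the cone
  spanned by its three edges there (\<open>simple_vertex_edges\<close>).
\<close>

section \<open>Supporting functionals of facets and the edges at a simple vertex\<close>

text \<open>
  The functionals are tied to facets rather than to a halfspace representation, so that the
  inequalities that are tight at a point correspond exactly to the facets through it.
\<close>

locale facet_functionals =
  fixes P :: "'a::euclidean_space set" and a :: "'a set \<Rightarrow> 'a" and b :: "'a set \<Rightarrow> real"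
  assumes polytope: "polytope P"
    and valid: "F facet_of P \<Longrightarrow> x \<in> P \<Longrightarrow> a F \<bullet> x \<le> b F"
    and facet_mem: "F facet_of P \<Longrightarrow> x \<in> F \<longleftrightarrow> x \<in> P \<and> a F \<bullet> x = b F"
begin

text \<open>
  Otherwise the segment from a relative interior point to \<open>x\<close> leaves \<open>P\<close> through a facet, and the
  functional of that facet increases strictly along the segment, so it exceeds its bound at \<open>x\<close>.
\<close>

lemma mem_if_facet_inequalities:
  assumes x: "x \<in> affine hull P" and le: "\<And>F. F facet_of P \<Longrightarrow> a F \<bullet> x \<le> b F"
  shows "x \<in> P"
proof -
  have "P \<noteq> {}" using x by auto
  then obtain z where z: "z \<in> rel_interior P"
    using polytope polytope_imp_convex rel_interior_eq_empty by blast
  have zP: "z \<in> P" using z rel_interior_subset by blast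
  show ?thesis
  proof (cases "x = z")
    case False
    then have "x - z \<noteq> 0" by simp
    moreover have "z + (x - z) \<in> affine hull P" using x by simp
    ultimately obtain d where d: "0 < d" "z + d *\<^sub>R (x - z) \<in> rel_frontier P"
      and int: "\<And>e. \<lbrakk>0 \<le> e; e < d\<rbrakk> \<Longrightarrow> z + e *\<^sub>R (x - z) \<in> rel_interior P"
      using ray_to_rel_frontier[OF polytope_imp_bounded[OF polytope] z] by blast
    obtain F where F: "F facet_of P" and y: "z + d *\<^sub>R (x - z) \<in> F"
      using d(2) rel_frontier_of_polyhedron[OF polytope_imp_polyhedron[OF polytope]] by auto
    have "F \<noteq> P" using F by auto
    then have "z \<notin> F"
      using F z face_of_disjoint_rel_interior[of F P] facet_of_imp_face_of by blast
    then have lt: "a F \<bullet> z < b F"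
      using facet_mem[OF F] valid[OF F] zP by force
    have eq: "a F \<bullet> z + d * (a F \<bullet> x - a F \<bullet> z) = b F" and yP: "z + d *\<^sub>R (x - z) \<in> P"
      using y facet_mem[OF F] by (auto simp: inner_simps)
    have "d \<ge> 1"
    proof (rule ccontr)
      assume "\<not> d \<ge> 1"
      moreover have pos: "a F \<bullet> x - a F \<bullet> z > 0"
        using eq lt d(1) by (metis add_less_cancel_left add.right_neutral zero_less_mult_pos)
      ultimately have "d * (a F \<bullet> x - a F \<bullet> z) < a F \<bullet> x - a F \<bullet> z" by simp
      then show False using eq le[OF F] by linarith
    qed
    then show ?thesis
      using yP int[of 1] rel_interior_subset by (cases "d = 1") auto
  qed (use zP in simp)
qed

text \<open>
  The facets that avoid \<open>v\<close> have positive slack at \<open>v\<close>, and there are only finitely many of them, so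
  a small step in direction \<open>d\<close> violates none of their inequalities.
\<close>

lemma feasible_direction:
  assumes v: "v \<in> P" and d: "v + d \<in> affine hull P"
    and le: "\<And>F. F facet_of P \<Longrightarrow> v \<in> F \<Longrightarrow> a F \<bullet> d \<le> 0"
  obtains \<epsilon> where "\<epsilon> > 0" "v + \<epsilon> *\<^sub>R d \<in> P"
proof -
  have fin: "finite {F. F facet_of P}" by (rule finite_polytope_facets[OF polytope])
  have "\<exists>\<epsilon>>0. \<epsilon> * (a F \<bullet> d) \<le> b F - a F \<bullet> v" if F: "F facet_of P" for F
  proof (cases "v \<in> F")
    case True
    then show ?thesis using le[OF F] facet_mem[OF F] by (intro exI[of _ 1]) auto
  next
    case False
    then have "a F \<bullet> v < b F" using valid[OF F v] facet_mem[OF F] v by force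
    then have B: "b F - a F \<bullet> v > 0" by simp
    then have "(b F - a F \<bullet> v) * (a F \<bullet> d) \<le> (b F - a F \<bullet> v) * (\<bar>a F \<bullet> d\<bar> + 1)"
      by (intro mult_left_mono) auto
    then have "(b F - a F \<bullet> v) / (\<bar>a F \<bullet> d\<bar> + 1) * (a F \<bullet> d) \<le> b F - a F \<bullet> v"
      by (simp add: divide_le_eq add_nonneg_pos)
    moreover have "(b F - a F \<bullet> v) / (\<bar>a F \<bullet> d\<bar> + 1) > 0"
      using B by (simp add: add_nonneg_pos)
    ultimately show ?thesis by blast
  qed
  then obtain e where e: "\<And>F. F facet_of P \<Longrightarrow> e F > 0 \<and> e F * (a F \<bullet> d) \<le> b F - a F \<bullet> v"
    by metis
  \<comment> \<open>The 1 keeps the set nonempty if there are no facets.\<close>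
  define \<epsilon> where "\<epsilon> = Min (insert 1 (e ` {F. F facet_of P}))"
  have pos: "\<epsilon> > 0" unfolding \<epsilon>_def using fin e by (subst Min_gr_iff) auto
  have le_e: "\<epsilon> \<le> e F" if "F facet_of P" for F
    unfolding \<epsilon>_def using fin that by (intro Min_le) auto
  have "v + \<epsilon> *\<^sub>R d \<in> P"
  proof (rule mem_if_facet_inequalities)
    have "(1 - \<epsilon>) *\<^sub>R v + \<epsilon> *\<^sub>R (v + d) \<in> affine hull P"
      using v d by (intro mem_affine) (auto simp: hull_inc)
    then show "v + \<epsilon> *\<^sub>R d \<in> affine hull P" by (simp add: algebra_simps)
  next
    fix F assume F: "F facet_of P"
    have "\<epsilon> * (a F \<bullet> d) \<le> b F - a F \<bullet> v"
    proof (cases "a F \<bullet> d \<le> 0")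
      case True
      then have "\<epsilon> * (a F \<bullet> d) \<le> 0" using pos by (simp add: mult_nonneg_nonpos)
      then show ?thesis using valid[OF F v] by linarith
    next
      case False
      then have "\<epsilon> * (a F \<bullet> d) \<le> e F * (a F \<bullet> d)"
        using le_e[OF F] by (intro mult_right_mono) auto
      then show ?thesis using e[OF F] by linarith
    qed
    then show "a F \<bullet> (v + \<epsilon> *\<^sub>R d) \<le> b F" by (simp add: inner_simps)
  qed
  then show ?thesis using that pos by blast
qed

text \<open>
  Both \<open>d\<close> and \<open>- d\<close> would be feasible directions at \<open>v\<close>, contradicting extremality. So the
  functionals of the facets at a vertex separate the directions in the affine hull; with exactly
  \<open>aff_dim P\<close> of them they act as coordinates.
\<close>

lemma direction_eq_0:
  assumes v: "v extreme_point_of P" and d: "v + d \<in> affine hull P"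
    and eq: "\<And>F. F facet_of P \<Longrightarrow> v \<in> F \<Longrightarrow> a F \<bullet> d = 0"
  shows "d = 0"
proof (rule ccontr)
  assume "d \<noteq> 0"
  have vP: "v \<in> P" using v by (simp add: extreme_point_of_def)
  have d': "v + (- d) \<in> affine hull P"
  proof -
    have "2 *\<^sub>R v + (-1) *\<^sub>R (v + d) \<in> affine hull P"
      using vP d by (intro mem_affine) (auto simp: hull_inc)
    then show ?thesis by (simp add: algebra_simps scaleR_2)
  qed
  obtain \<epsilon> where \<epsilon>: "\<epsilon> > 0" "v + \<epsilon> *\<^sub>R d \<in> P"
    using feasible_direction[OF vP d] eq by (metis order_refl)
  obtain \<delta> where \<delta>: "\<delta> > 0" "v + \<delta> *\<^sub>R (- d) \<in> P"
    using feasible_direction[OF vP d'] eq by (metis inner_minus_right neg_equal_zero order_refl)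
  have "v \<in> open_segment (v + \<epsilon> *\<^sub>R d) (v + \<delta> *\<^sub>R (- d))"
    unfolding in_segment
  proof (intro conjI exI[of _ "\<epsilon> / (\<epsilon> + \<delta>)"])
    show "v + \<epsilon> *\<^sub>R d \<noteq> v + \<delta> *\<^sub>R (- d)"
    proof
      assume "v + \<epsilon> *\<^sub>R d = v + \<delta> *\<^sub>R (- d)"
      then have "(\<epsilon> + \<delta>) *\<^sub>R d = 0" by (simp add: scaleR_left_distrib)
      then show False using \<epsilon>(1) \<delta>(1) \<open>d \<noteq> 0\<close> by simp
    qed
    have "1 - \<epsilon> / (\<epsilon> + \<delta>) = \<delta> / (\<epsilon> + \<delta>)" using \<epsilon>(1) \<delta>(1) by (simp add: field_simps)
    moreover have "(\<delta> / (\<epsilon> + \<delta>)) *\<^sub>R v + (\<epsilon> / (\<epsilon> + \<delta>)) *\<^sub>R v = v"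
      using \<epsilon>(1) \<delta>(1) by (simp flip: scaleR_left_distrib add_divide_distrib add: add.commute)
    ultimately show "v = (1 - \<epsilon> / (\<epsilon> + \<delta>)) *\<^sub>R (v + \<epsilon> *\<^sub>R d) + (\<epsilon> / (\<epsilon> + \<delta>)) *\<^sub>R (v + \<delta> *\<^sub>R - d)"
      by (simp add: scaleR_right_distrib scaleR_right_diff_distrib mult.commute)
  qed (use \<epsilon>(1) \<delta>(1) in simp_all)
  then show False using v \<epsilon>(2) \<delta>(2) by (auto simp: extreme_point_of_def)
qed

end

lemma facet_functionals_exist:
  assumes "polytope P"
  obtains a b where "facet_functionals P a b"
proof -
  have "\<exists>a b. P \<subseteq> {x. a \<bullet> x \<le> b} \<and> F = P \<inter> {x. a \<bullet> x = b}" if "F facet_of P" for F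
    using exposed_face_of_polyhedron[OF polytope_imp_polyhedron[OF assms]] that
    unfolding exposed_face_of_def facet_of_def by blast
  then obtain a b where "\<And>F. F facet_of P \<Longrightarrow> P \<subseteq> {x. a F \<bullet> x \<le> b F} \<and> F = P \<inter> {x. a F \<bullet> x = b F}"
    by metis
  then have "facet_functionals P a b" using assms by unfold_locales blast+
  then show ?thesis by (rule that)
qed

lemma aff_dim_Int_hyperplanes_ge:
  fixes A :: "'a::euclidean_space set"
  assumes "finite I" "affine A" "v \<in> A" "\<And>i. i \<in> I \<Longrightarrow> g i \<bullet> v = h i"
  shows "aff_dim (A \<inter> {x. \<forall>i\<in>I. g i \<bullet> x = h i}) \<ge> aff_dim A - int (card I)"
  using assms
proof (induction I rule: finite_induct)
  case (insert i I)
  let ?B = "A \<inter> {x. \<forall>i\<in>I. g i \<bullet> x = h i}"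
  have "affine ?B"
  proof -
    have "{x. \<forall>i\<in>I. g i \<bullet> x = h i} = (\<Inter>i\<in>I. {x. g i \<bullet> x = h i})" by auto
    then show ?thesis using insert.prems by (auto intro!: affine_Int affine_Inter affine_hyperplane)
  qed
  then have "aff_dim (?B \<inter> {x. g i \<bullet> x = h i}) \<ge> aff_dim ?B - 1"
    using aff_dim_affine_Int_hyperplane[of ?B "g i" "h i"] insert.prems by auto
  moreover have "?B \<inter> {x. g i \<bullet> x = h i} = A \<inter> {x. \<forall>i\<in>insert i I. g i \<bullet> x = h i}" by auto
  ultimately show ?case using insert by (simp add: insert.prems)
qed auto

text \<open>
  With as many facets at \<open>v\<close> as the dimension, omitting one facet \<open>F\<close> leaves a line along which only
  the functional of \<open>F\<close> varies. Its part in \<open>P\<close> is the edge from \<open>v\<close> to \<open>w F\<close>. The edge directions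
  are dual to the facet functionals up to scaling, so every point of \<open>P\<close> has
  nonnegative coordinates with respect to them, and the coordinate that belongs to \<open>F\<close> vanishes on \<open>F\<close>.
\<close>

lemma simple_vertex_edges:
  fixes P :: "'a::euclidean_space set"
  defines "\<F> \<equiv> \<lambda>v. {F. F facet_of P \<and> v \<in> F}"
  assumes P: "polytope P" and v: "v extreme_point_of P"
    and simple: "int (card (\<F> v)) = aff_dim P"
  obtains w where
    "\<And>F. F \<in> \<F> v \<Longrightarrow> w F extreme_point_of P"
    "\<And>F. F \<in> \<F> v \<Longrightarrow> w F \<notin> F"
    "\<And>F G. F \<in> \<F> v \<Longrightarrow> G \<in> \<F> v \<Longrightarrow> F \<noteq> G \<Longrightarrow> w F \<in> G"
    "\<And>F x. F \<in> \<F> v \<Longrightarrow> x \<in> P \<Longrightarrow> (\<And>G. G \<in> \<F> v - {F} \<Longrightarrow> x \<in> G) \<Longrightarrow> x \<in> closed_segment v (w F)"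
    "\<And>x. x \<in> P \<Longrightarrow> \<exists>t. x = v + (\<Sum>F\<in>\<F> v. t F *\<^sub>R (w F - v)) \<and>
        (\<forall>F\<in>\<F> v. 0 \<le> t F \<and> (x \<in> F \<longrightarrow> t F = 0))"
proof -
  obtain a b where "facet_functionals P a b" using facet_functionals_exist[OF P] .
  then interpret facet_functionals P a b .
  have vP: "v \<in> P" using v by (simp add: extreme_point_of_def)
  have fin: "finite (\<F> v)"
    using finite_polytope_facets[OF P] unfolding \<F>_def by (rule rev_finite_subset) auto
  have av: "a F \<bullet> v = b F" if "F \<in> \<F> v" for F using that facet_mem by (auto simp: \<F>_def)
  define L where "L = {d. v + d \<in> affine hull P}"
  have L: "subspace L"
  proof -
    have "L = (\<lambda>x. - v + x) ` (affine hull P)"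
      unfolding L_def by (force simp: image_iff)
    then show ?thesis using affine_diffs_subspace[of "affine hull P" v] vP by (simp add: hull_inc)
  qed
  have L0: "d = 0" if "d \<in> L" "\<And>F. F \<in> \<F> v \<Longrightarrow> a F \<bullet> d = 0" for d
    using direction_eq_0[OF v, of d] that by (auto simp: L_def \<F>_def)
  have PL: "x - v \<in> L" if "x \<in> P" for x using that by (simp add: L_def hull_inc)
  have ex: "\<exists>w. w extreme_point_of P \<and> w \<notin> F \<and> (\<forall>G\<in>\<F> v - {F}. w \<in> G) \<and>
     (\<forall>x\<in>P. (\<forall>G\<in>\<F> v - {F}. x \<in> G) \<longrightarrow> x \<in> closed_segment v w)" if F: "F \<in> \<F> v" for F
  proof -
    \<comment> \<open>The line through the edge, and the edge itself.\<close>
    let ?M = "affine hull P \<inter> {x. \<forall>G\<in>\<F> v - {F}. a G \<bullet> x = b G}"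
    let ?E = "P \<inter> {x. \<forall>G\<in>\<F> v - {F}. x \<in> G}"
    have "aff_dim ?M \<ge> aff_dim (affine hull P) - int (card (\<F> v - {F}))"
      using fin vP av by (intro aff_dim_Int_hyperplanes_ge[of _ _ v]) (auto simp: hull_inc)
    moreover have "card (\<F> v - {F}) = card (\<F> v) - 1" "card (\<F> v) > 0"
      using F fin by (auto simp: card_gt_0_iff)
    ultimately have "aff_dim ?M \<ge> 1" using simple by simp
    moreover have "v \<in> ?M" using vP av by (auto simp: hull_inc)
    ultimately have "\<not> ?M \<subseteq> {v}"
      using aff_dim_subset[of ?M "{v}"] by (auto simp del: subset_insert_iff)
    then obtain x where x: "x \<in> ?M" "x \<noteq> v" by blast
    have xL: "x - v \<in> L" using x by (simp add: L_def)
    have x0: "a G \<bullet> (x - v) = 0" if "G \<in> \<F> v - {F}" for G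
      using x av that by (auto simp: inner_simps)
    have "a F \<bullet> (x - v) \<noteq> 0"
      using L0[OF xL] x0 x(2) by (metis DiffI right_minus_eq singletonD)
    then obtain d where dL: "d \<in> L" and dF: "a F \<bullet> d < 0"
      and dG: "\<And>G. G \<in> \<F> v - {F} \<Longrightarrow> a G \<bullet> d = 0"
    proof (cases "a F \<bullet> (x - v) < 0")
      case True
      then show ?thesis using that xL x0 by blast
    next
      case False
      moreover have "- (x - v) \<in> L" using subspace_neg[OF L xL] .
      ultimately show ?thesis
        using that[of "- (x - v)"] x0 \<open>a F \<bullet> (x - v) \<noteq> 0\<close>
        by (simp add: inner_diff_right)
    qed
    have "a G \<bullet> d \<le> 0" if "G facet_of P" "v \<in> G" for G
      using that dF dG[of G] by (cases "G = F") (auto simp: \<F>_def)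
    then obtain \<epsilon> where \<epsilon>: "\<epsilon> > 0" "v + \<epsilon> *\<^sub>R d \<in> P"
      using feasible_direction[OF vP, of d] dL by (auto simp: L_def)
    let ?y = "v + \<epsilon> *\<^sub>R d"
    have yE: "?y \<in> ?E"
      using \<epsilon>(2) dG av by (auto simp: \<F>_def facet_mem inner_simps)
    have ynv: "?y \<noteq> v" using \<epsilon>(1) dF by auto
    have "?E face_of P"
    proof -
      have "?E = \<Inter> (insert P (\<F> v - {F}))" by auto
      moreover have "\<Inter> (insert P (\<F> v - {F})) face_of P"
        by (rule face_of_Inter) (auto simp: \<F>_def facet_of_imp_face_of face_of_refl polytope_imp_convex P)
      ultimately show ?thesis by simp
    qed
    have line: "\<exists>s. z = v + s *\<^sub>R d" if "z \<in> ?E" for z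
    proof -
      define s where "s = (a F \<bullet> (z - v)) / (a F \<bullet> d)"
      have "(z - v) - s *\<^sub>R d = 0"
      proof (rule L0)
        show "z - v - s *\<^sub>R d \<in> L"
          using subspace_diff[OF L PL subspace_mul[OF L dL]] that by blast
      next
        fix G assume G: "G \<in> \<F> v"
        show "a G \<bullet> (z - v - s *\<^sub>R d) = 0"
        proof (cases "G = F")
          case True
          then show ?thesis using dF by (simp add: inner_diff_right s_def)
        next
          case False
          then have "z \<in> G" using that G by auto
          then show ?thesis
            using dG[of G] G False av facet_mem by (auto simp: inner_diff_right \<F>_def)
        qed
      qed
      then have "z = v + s *\<^sub>R d" by (simp add: algebra_simps)
      then show ?thesis ..
    qed
    have coll: "collinear ?E"
      unfolding collinear_def
    proof (intro exI[of _ d] ballI)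
      fix p q assume "p \<in> ?E" "q \<in> ?E"
      then obtain s t where "p = v + s *\<^sub>R d" "q = v + t *\<^sub>R d" using line by meson
      then have "p - q = (s - t) *\<^sub>R d" by (simp add: scaleR_diff_left)
      then show "\<exists>c. p - q = c *\<^sub>R d" ..
    qed
    have vE: "v \<in> ?E" using vP by (auto simp: \<F>_def)
    have poly: "polytope ?E" using \<open>?E face_of P\<close> P face_of_polytope_polytope by blast
    obtain p q where pq: "?E = closed_segment p q"
      using compact_convex_collinear_segment[OF _ polytope_imp_compact[OF poly] polytope_imp_convex[OF poly] coll] vE
      by blast
    have "v extreme_point_of ?E" using \<open>?E face_of P\<close> v vE extreme_point_of_face by blast
    then have vpq: "v = p \<or> v = q" by (simp add: pq extreme_point_of_segment)
    obtain w where w: "?E = closed_segment v w"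
    proof (cases "v = p")
      case True
      then show ?thesis using that[of q] pq by simp
    next
      case False
      then have "v = q" using vpq by blast
      have "closed_segment p q = closed_segment v p"
        unfolding \<open>v = q\<close> by (rule closed_segment_commute)
      then show ?thesis using that[of p] pq by simp
    qed
    have wv: "w \<noteq> v" using yE ynv w by auto
    have "w extreme_point_of ?E" unfolding w extreme_point_of_segment by simp
    then have wP: "w extreme_point_of P" and wE: "w \<in> ?E"
      using \<open>?E face_of P\<close> extreme_point_of_face by blast+
    have "w \<notin> F"
    proof
      assume "w \<in> F"
      then have "w \<in> G" if "G \<in> \<F> v" for G using that wE by (cases "G = F") auto
      then have "a G \<bullet> (w - v) = 0" if "G \<in> \<F> v" for G
        using that av facet_mem by (auto simp: \<F>_def inner_diff_right)
      then show False using L0[OF PL, of w] wv wE by auto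
    qed
    moreover have "\<forall>G\<in>\<F> v - {F}. w \<in> G" using wE by simp
    moreover have "\<forall>x\<in>P. (\<forall>G\<in>\<F> v - {F}. x \<in> G) \<longrightarrow> x \<in> closed_segment v w"
      unfolding w[symmetric] by simp
    ultimately show ?thesis using wP by (intro exI[of _ w] conjI)
  qed
  then obtain w where w: "\<And>F. F \<in> \<F> v \<Longrightarrow> w F extreme_point_of P \<and> w F \<notin> F \<and> (\<forall>G\<in>\<F> v - {F}. w F \<in> G) \<and>
     (\<forall>x\<in>P. (\<forall>G\<in>\<F> v - {F}. x \<in> G) \<longrightarrow> x \<in> closed_segment v (w F))"
    by metis
  have w1: "\<And>F. F \<in> \<F> v \<Longrightarrow> w F extreme_point_of P"
    and w2: "\<And>F. F \<in> \<F> v \<Longrightarrow> w F \<notin> F"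
    and w3: "\<And>F G. F \<in> \<F> v \<Longrightarrow> G \<in> \<F> v \<Longrightarrow> F \<noteq> G \<Longrightarrow> w F \<in> G"
    and w4: "\<And>F x. F \<in> \<F> v \<Longrightarrow> x \<in> P \<Longrightarrow> (\<And>G. G \<in> \<F> v - {F} \<Longrightarrow> x \<in> G) \<Longrightarrow> x \<in> closed_segment v (w F)"
    using w by auto
  have wP: "w F \<in> P" if "F \<in> \<F> v" for F using w1[OF that] by (simp add: extreme_point_of_def)
  have wF: "a F \<bullet> (w F - v) < 0" if "F \<in> \<F> v" for F
    using wP[OF that] w2[OF that] valid[of F "w F"] facet_mem[of F "w F"] av[OF that] that
    by (fastforce simp: \<F>_def inner_diff_right)
  have wG: "a G \<bullet> (w F - v) = 0" if "F \<in> \<F> v" "G \<in> \<F> v" "F \<noteq> G" for F G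
    using w3[OF that] facet_mem[of G "w F"] av that by (auto simp: \<F>_def inner_diff_right)
  have "\<exists>t. x = v + (\<Sum>F\<in>\<F> v. t F *\<^sub>R (w F - v)) \<and>
        (\<forall>F\<in>\<F> v. 0 \<le> t F \<and> (x \<in> F \<longrightarrow> t F = 0))" if x: "x \<in> P" for x
  proof -
    define t where "t = (\<lambda>F. a F \<bullet> (x - v) / (a F \<bullet> (w F - v)))"
    have "x - v - (\<Sum>F\<in>\<F> v. t F *\<^sub>R (w F - v)) = 0"
    proof (rule L0)
      show "x - v - (\<Sum>F\<in>\<F> v. t F *\<^sub>R (w F - v)) \<in> L"
        by (rule subspace_diff[OF L PL[OF x] subspace_sum[OF L subspace_mul[OF L PL[OF wP]]]])
    next
      fix G assume G: "G \<in> \<F> v"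
      have "a G \<bullet> (\<Sum>F\<in>\<F> v. t F *\<^sub>R (w F - v)) = (\<Sum>F\<in>\<F> v. t F * (a G \<bullet> (w F - v)))"
        by (simp add: inner_sum_right)
      also have "\<dots> = (\<Sum>F\<in>\<F> v. if F = G then t G * (a G \<bullet> (w G - v)) else 0)"
        using G wG by (intro sum.cong) auto
      also have "\<dots> = a G \<bullet> (x - v)" using G fin wF[OF G] by (simp add: t_def)
      finally show "a G \<bullet> (x - v - (\<Sum>F\<in>\<F> v. t F *\<^sub>R (w F - v))) = 0"
        by (simp add: inner_diff_right)
    qed
    then have "x = v + (\<Sum>F\<in>\<F> v. t F *\<^sub>R (w F - v))"
      by (simp only: diff_diff_eq right_minus_eq)
    moreover have "0 \<le> t F \<and> (x \<in> F \<longrightarrow> t F = 0)" if "F \<in> \<F> v" for F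
    proof -
      have "a F \<bullet> (x - v) \<le> 0" using valid[of F x] av[OF that] x that by (auto simp: inner_diff_right \<F>_def)
      moreover have "x \<in> F \<Longrightarrow> a F \<bullet> (x - v) = 0"
        using facet_mem[of F x] av[OF that] that by (auto simp: inner_diff_right \<F>_def)
      ultimately show ?thesis using wF[OF that] by (auto simp: t_def divide_nonpos_neg)
    qed
    ultimately show ?thesis by (intro exI[of _ t]) blast
  qed
  then show ?thesis
  proof (rule that[of w, rotated 4])
    fix F assume F: "F \<in> \<F> v"
    show "w F extreme_point_of P" "w F \<notin> F" using F by (fact w1, fact w2)
    show "w F \<in> G" if "G \<in> \<F> v" "F \<noteq> G" for G using F that by (rule w3)
    show "x \<in> closed_segment v (w F)" if "x \<in> P" "\<And>G. G \<in> \<F> v - {F} \<Longrightarrow> x \<in> G" for x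
      using F that by (rule w4)
  qed
qed

section \<open>Simple 3-polytopes\<close>

text \<open>
  The functionals that identify two given distinct points form a hyperplane, and finitely many
  hyperplanes do not cover the space because they are null sets.
\<close>

lemma exists_inner_inj_on:
  fixes S :: "'a::euclidean_space set"
  assumes "finite S"
  obtains l :: 'a where "inj_on ((\<bullet>) l) S"
proof -
  define D where "D = {x - y |x y. x \<in> S \<and> y \<in> S \<and> x \<noteq> y}"
  have "finite D"
    by (rule finite_subset[of _ "(\<lambda>(x, y). x - y) ` (S \<times> S)"]) (use assms in \<open>auto simp: D_def\<close>)
  moreover have "negligible {l. d \<bullet> l = 0}" if "d \<in> D" for d
    using that by (intro negligible_hyperplane) (auto simp: D_def)
  ultimately have "negligible (\<Union>d\<in>D. {l. d \<bullet> l = 0})" by (intro negligible_Union) auto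
  then have "(\<Union>d\<in>D. {l. d \<bullet> l = 0}) \<noteq> UNIV" using non_negligible_UNIV by metis
  then obtain l where l: "\<And>d. d \<in> D \<Longrightarrow> d \<bullet> l \<noteq> 0" by auto
  have "inj_on ((\<bullet>) l) S"
  proof (rule inj_onI, rule ccontr)
    fix x y assume "x \<in> S" "y \<in> S" "l \<bullet> x = l \<bullet> y" "x \<noteq> y"
    then show False using l[of "x - y"] by (auto simp: D_def inner_diff_right inner_commute[of _ l])
  qed
  then show ?thesis by (rule that)
qed

lemma finite_lowest:
  fixes f :: "'a \<Rightarrow> 'b::linorder"
  assumes "finite V" "V \<noteq> {}"
  obtains v where "v \<in> V" "\<And>x. x \<in> V \<Longrightarrow> f v \<le> f x"
proof (rule that[of "arg_min_on f V"])
  show "arg_min_on f V \<in> V" by (rule arg_min_if_finite(1)[OF assms])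
  show "f (arg_min_on f V) \<le> f x" if "x \<in> V" for x by (rule arg_min_least[OF assms that])
qed

lemma polytope_vertex_exists:
  fixes F :: "'a::euclidean_space set"
  assumes "polytope F" "F \<noteq> {}"
  obtains v where "v extreme_point_of F"
  using extreme_point_exists_convex[OF polytope_imp_compact[OF assms(1)] polytope_imp_convex[OF assms(1)] assms(2)] .

locale simple_3d_polytope =
  fixes P :: "'a::euclidean_space set" and star :: "'a \<Rightarrow> 'a set set"
  defines "star \<equiv> \<lambda>v. {F \<in> two_faces P. v \<in> F}"
  assumes simple: "simple_3_polytope P"
begin

lemma polytope: "polytope P" and aff_dim: "aff_dim P = 3"
  and card_star: "v \<in> vertices P \<Longrightarrow> card (star v) = 3"
  using simple unfolding simple_3_polytope_def star_def by auto

lemma finite_vertices: "finite (vertices P)"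
  unfolding vertices_def using finite_polyhedron_extreme_points[OF polytope_imp_polyhedron[OF polytope]] .

lemma two_faces_eq: "two_faces P = {F. F facet_of P}"
  by (auto simp: two_faces_def facet_of_def aff_dim)

lemma finite_two_faces: "finite (two_faces P)"
  unfolding two_faces_eq by (rule finite_polytope_facets[OF polytope])

lemma finite_star: "finite (star v)"
  unfolding star_def using finite_two_faces by simp

lemma two_face_polytope: "F \<in> two_faces P \<Longrightarrow> polytope F"
  using polytope face_of_polytope_polytope by (auto simp: two_faces_def)

lemma vertex_of_two_face: "F \<in> two_faces P \<Longrightarrow> v extreme_point_of F \<longleftrightarrow> v \<in> vertices P \<and> v \<in> F"
  using extreme_point_of_face by (auto simp: two_faces_def vertices_def)

lemma two_face_has_vertex:
  assumes "F \<in> two_faces P" obtains v where "v \<in> vertices P" "v \<in> F"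
proof -
  have "F \<noteq> {}" using assms by (auto simp: two_faces_def)
  then show ?thesis
    using polytope_vertex_exists[OF two_face_polytope] assms vertex_of_two_face that by metis
qed

lemma two_face_eq_hull: "F \<in> two_faces P \<Longrightarrow> F = convex hull (vertices P \<inter> F)"
  using Krein_Milman_Minkowski[OF polytope_imp_compact polytope_imp_convex, OF two_face_polytope two_face_polytope, of F]
  by (simp add: vertex_of_two_face Int_def)

text \<open>
  The neighbours provided by \<open>simple_vertex_edges\<close>: \<open>nb v F\<close> is the other end of the edge at \<open>v\<close>
  that lies in the two faces at \<open>v\<close> other than \<open>F\<close>. Indexing the neighbours by the face that
  they leave makes the description of the edges symmetric.
\<close>

definition nb :: "'a \<Rightarrow> 'a set \<Rightarrow> 'a" where
  "nb v = (SOME w.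
    (\<forall>F\<in>star v. w F \<in> vertices P \<and> w F \<notin> F \<and> (\<forall>G\<in>star v - {F}. w F \<in> G) \<and>
      (\<forall>x\<in>P. (\<forall>G\<in>star v - {F}. x \<in> G) \<longrightarrow> x \<in> closed_segment v (w F))) \<and>
    (\<forall>x\<in>P. \<exists>t. x = v + (\<Sum>F\<in>star v. t F *\<^sub>R (w F - v)) \<and>
        (\<forall>F\<in>star v. 0 \<le> t F \<and> (x \<in> F \<longrightarrow> t F = 0))))"

lemma nb:
  assumes v: "v \<in> vertices P"
  shows "\<And>F. F \<in> star v \<Longrightarrow> nb v F \<in> vertices P"
    and "\<And>F. F \<in> star v \<Longrightarrow> nb v F \<notin> F"
    and "\<And>F G. F \<in> star v \<Longrightarrow> G \<in> star v \<Longrightarrow> F \<noteq> G \<Longrightarrow> nb v F \<in> G"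
    and "\<And>F x. F \<in> star v \<Longrightarrow> x \<in> P \<Longrightarrow> \<forall>G\<in>star v - {F}. x \<in> G \<Longrightarrow> x \<in> closed_segment v (nb v F)"
    and "\<And>x. x \<in> P \<Longrightarrow> \<exists>t. x = v + (\<Sum>F\<in>star v. t F *\<^sub>R (nb v F - v)) \<and>
        (\<forall>F\<in>star v. 0 \<le> t F \<and> (x \<in> F \<longrightarrow> t F = 0))"
proof -
  have star: "{F. F facet_of P \<and> v \<in> F} = star v" by (simp add: star_def two_faces_eq)
  have ex: "\<exists>w. (\<forall>F\<in>star v. w F \<in> vertices P \<and> w F \<notin> F \<and> (\<forall>G\<in>star v - {F}. w F \<in> G) \<and>
      (\<forall>x\<in>P. (\<forall>G\<in>star v - {F}. x \<in> G) \<longrightarrow> x \<in> closed_segment v (w F))) \<and>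
    (\<forall>x\<in>P. \<exists>t. x = v + (\<Sum>F\<in>star v. t F *\<^sub>R (w F - v)) \<and>
        (\<forall>F\<in>star v. 0 \<le> t F \<and> (x \<in> F \<longrightarrow> t F = 0)))"
  proof (rule simple_vertex_edges[OF polytope, of v, unfolded star])
    show "v extreme_point_of P" using v by (simp add: vertices_def)
    show "int (card (star v)) = aff_dim P" by (simp add: card_star[OF v] aff_dim)
  next
    fix w
    assume w: "\<And>F. F \<in> star v \<Longrightarrow> w F extreme_point_of P"
      "\<And>F. F \<in> star v \<Longrightarrow> w F \<notin> F"
      "\<And>F G. \<lbrakk>F \<in> star v; G \<in> star v; F \<noteq> G\<rbrakk> \<Longrightarrow> w F \<in> G"
      "\<And>F x. \<lbrakk>F \<in> star v; x \<in> P; \<And>G. G \<in> star v - {F} \<Longrightarrow> x \<in> G\<rbrakk> \<Longrightarrow> x \<in> closed_segment v (w F)"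
      "\<And>x. x \<in> P \<Longrightarrow> \<exists>t. x = v + (\<Sum>F\<in>star v. t F *\<^sub>R (w F - v)) \<and>
        (\<forall>F\<in>star v. 0 \<le> t F \<and> (x \<in> F \<longrightarrow> t F = 0))"
    show ?thesis
    proof (rule exI[of _ w], intro conjI ballI impI)
      fix F x assume "F \<in> star v" "x \<in> P" "\<forall>G\<in>star v - {F}. x \<in> G"
      then show "x \<in> closed_segment v (w F)" by (intro w(4)) auto
    qed (use w(1-3,5) in \<open>auto simp: vertices_def\<close>)
  qed
  note n = someI_ex[OF ex, folded nb_def]
  show "\<And>F. F \<in> star v \<Longrightarrow> nb v F \<in> vertices P"
    and "\<And>F. F \<in> star v \<Longrightarrow> nb v F \<notin> F"
    and "\<And>F G. F \<in> star v \<Longrightarrow> G \<in> star v \<Longrightarrow> F \<noteq> G \<Longrightarrow> nb v F \<in> G"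
    and "\<And>F x. F \<in> star v \<Longrightarrow> x \<in> P \<Longrightarrow> \<forall>G\<in>star v - {F}. x \<in> G \<Longrightarrow> x \<in> closed_segment v (nb v F)"
    and "\<And>x. x \<in> P \<Longrightarrow> \<exists>t. x = v + (\<Sum>F\<in>star v. t F *\<^sub>R (nb v F - v)) \<and>
        (\<forall>F\<in>star v. 0 \<le> t F \<and> (x \<in> F \<longrightarrow> t F = 0))"
    using n by blast+
qed

lemma nb_neq: "v \<in> vertices P \<Longrightarrow> F \<in> star v \<Longrightarrow> nb v F \<noteq> v"
  using nb(2)[of v F] by (auto simp: star_def)

lemma star_eq:
  assumes "v \<in> vertices P" "F \<in> star v" "G \<in> star v" "F \<noteq> G"
  obtains H where "star v = {F, G, H}" "H \<noteq> F" "H \<noteq> G"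
proof -
  have "card (star v - {F, G}) = 1"
    using assms card_star finite_star by (subst card_Diff_subset) auto
  then obtain H where "star v - {F, G} = {H}" by (auto simp: card_1_singleton_iff)
  then show ?thesis using assms that[of H] by blast
qed

lemma aff_dim_Int_adjacent:
  assumes v: "v \<in> vertices P" and FG: "F \<in> star v" "G \<in> star v" "F \<noteq> G"
  shows "aff_dim (F \<inter> G) = 1"
proof -
  obtain H where H: "star v = {F, G, H}" "H \<noteq> F" "H \<noteq> G" using star_eq[OF assms] .
  have sub: "F \<inter> G \<subseteq> closed_segment v (nb v H)"
  proof
    fix x assume "x \<in> F \<inter> G"
    moreover have "F \<subseteq> P" using FG(1) face_of_imp_subset by (auto simp: star_def two_faces_def)
    ultimately have "x \<in> P" "x \<in> F" "x \<in> G" by auto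
    then show "x \<in> closed_segment v (nb v H)" using H(1) by (intro nb(4)[OF v, of H]) auto
  qed
  have "{v, nb v H} \<subseteq> F \<inter> G"
    using H FG nb(3)[OF v, of H] by (auto simp: star_def)
  moreover have "v \<noteq> nb v H" using nb_neq[OF v, of H] H by auto
  ultimately have "aff_dim (F \<inter> G) \<ge> 1" using aff_dim_subset[of "{v, nb v H}" "F \<inter> G"] by simp
  moreover have "aff_dim (closed_segment v (nb v H)) = 1"
    using \<open>v \<noteq> nb v H\<close> by (simp add: segment_convex_hull aff_dim_convex_hull)
  ultimately show ?thesis using aff_dim_subset[OF sub] by simp
qed

text \<open>
  The polytope lies in the cone at \<open>v\<close> spanned by the edges, so \<open>l\<close> can only take smaller values
  in \<open>P\<close> than at \<open>v\<close> if it decreases along some edge.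
\<close>

lemma descending_neighbour:
  assumes v: "v \<in> vertices P" and x: "x \<in> P" "l \<bullet> x < l \<bullet> v"
  obtains F where "F \<in> star v" "l \<bullet> nb v F < l \<bullet> v"
proof -
  obtain t where t: "x = v + (\<Sum>F\<in>star v. t F *\<^sub>R (nb v F - v))" "\<And>F. F \<in> star v \<Longrightarrow> 0 \<le> t F"
    using nb(5)[OF v x(1)] by blast
  have "l \<bullet> x = l \<bullet> v + (\<Sum>F\<in>star v. t F * (l \<bullet> nb v F - l \<bullet> v))"
    by (subst t(1)) (simp add: inner_add_right inner_sum_right inner_diff_right)
  then have "(\<Sum>F\<in>star v. t F * (l \<bullet> nb v F - l \<bullet> v)) < 0" using x(2) by simp
  then obtain F where F: "F \<in> star v" "t F * (l \<bullet> nb v F - l \<bullet> v) < 0"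
    using sum_nonneg[of "star v" "\<lambda>F. t F * (l \<bullet> nb v F - l \<bullet> v)"] by (meson not_less)
  then have "l \<bullet> nb v F < l \<bullet> v" using t(2)[OF F(1)] by (simp add: mult_less_0_iff)
  then show ?thesis using that F(1) by blast
qed

text \<open>
  This is the connectedness of the graph of \<open>P\<close>: with a functional that exposes the vertex \<open>u\<close>,
  every other vertex has a neighbour closer to \<open>u\<close> in terms of the functional, and repeating this leads to \<open>u\<close>.
\<close>

lemma edge_invariant_constant:
  assumes inv: "\<And>v F. v \<in> vertices P \<Longrightarrow> F \<in> star v \<Longrightarrow> f (nb v F) = f v"
    and "u \<in> vertices P" "v \<in> vertices P"
  shows "f u = f v"
proof -
  have "{u} face_of P" using assms(2) by (simp add: vertices_def face_of_singleton)
  then obtain l b where l: "P \<subseteq> {x. l \<bullet> x \<le> b}" "{u} = P \<inter> {x. l \<bullet> x = b}"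
    using exposed_face_of_polyhedron[OF polytope_imp_polyhedron[OF polytope]]
    unfolding exposed_face_of_def by blast
  have vP: "x \<in> P" if "x \<in> vertices P" for x using that by (simp add: vertices_def extreme_point_of_def)
  have "v \<in> vertices P \<Longrightarrow> f u = f v"
  proof (induction "card {x \<in> vertices P. l \<bullet> x > l \<bullet> v}" arbitrary: v rule: less_induct)
    case less
    show ?case
    proof (cases "v = u")
      case False
      have "l \<bullet> u = b" using l(2) by blast
      moreover have "l \<bullet> v \<le> b" "l \<bullet> v \<noteq> b" using l vP[OF less.prems] False by blast+
      ultimately have "- l \<bullet> u < - l \<bullet> v" by simp
      moreover have "u \<in> P" using l by blast
      ultimately obtain F where F: "F \<in> star v" "- l \<bullet> nb v F < - l \<bullet> v"
        using descending_neighbour[OF less.prems, of u "- l"] by blast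
      have nv: "nb v F \<in> vertices P" using nb(1)[OF less.prems F(1)] .
      have "{x \<in> vertices P. l \<bullet> x > l \<bullet> nb v F} \<subset> {x \<in> vertices P. l \<bullet> x > l \<bullet> v}"
        using F(2) nv by force
      then have "card {x \<in> vertices P. l \<bullet> x > l \<bullet> nb v F} < card {x \<in> vertices P. l \<bullet> x > l \<bullet> v}"
        using finite_vertices by (intro psubset_card_mono) auto
      then show ?thesis using less.hyps nv inv[OF less.prems F(1)] by simp
    qed simp
  qed
  then show ?thesis using assms(3) .
qed

text \<open>
  The face \<open>F\<close> lies in the cone spanned by the two edges at \<open>v\<close> inside \<open>F\<close>, which are those
  towards the neighbours indexed by the other two faces at \<open>v\<close>.
\<close>

lemma lowest_in_face_iff:
  assumes v: "v \<in> vertices P" and F: "F \<in> star v" and inj: "inj_on ((\<bullet>) l) (vertices P)"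
  shows "(\<forall>x\<in>F. l \<bullet> v \<le> l \<bullet> x) \<longleftrightarrow> star v - {F} \<subseteq> {G \<in> star v. l \<bullet> v < l \<bullet> nb v G}"
proof
  assume low: "\<forall>x\<in>F. l \<bullet> v \<le> l \<bullet> x"
  show "star v - {F} \<subseteq> {G \<in> star v. l \<bullet> v < l \<bullet> nb v G}"
  proof
    fix G assume G: "G \<in> star v - {F}"
    then have "l \<bullet> v \<le> l \<bullet> nb v G" using low nb(3)[OF v _ F, of G] by auto
    moreover have "l \<bullet> v \<noteq> l \<bullet> nb v G"
      using inj_onD[OF inj _ v nb(1)[OF v, of G]] nb_neq[OF v, of G] G by auto
    ultimately show "G \<in> {G \<in> star v. l \<bullet> v < l \<bullet> nb v G}" using G by auto
  qed
next
  assume up: "star v - {F} \<subseteq> {G \<in> star v. l \<bullet> v < l \<bullet> nb v G}"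
  show "\<forall>x\<in>F. l \<bullet> v \<le> l \<bullet> x"
  proof
    fix x assume x: "x \<in> F"
    have "x \<in> P" using x F face_of_imp_subset by (auto simp: star_def two_faces_def)
    then obtain t where t: "x = v + (\<Sum>G\<in>star v. t G *\<^sub>R (nb v G - v))"
      "\<And>G. G \<in> star v \<Longrightarrow> 0 \<le> t G" "t F = 0"
      using nb(5)[OF v, of x] x F by blast
    have "l \<bullet> x = l \<bullet> v + (\<Sum>G\<in>star v. t G * (l \<bullet> nb v G - l \<bullet> v))"
      by (subst t(1)) (simp add: inner_add_right inner_sum_right inner_diff_right)
    moreover have "0 \<le> t G * (l \<bullet> nb v G - l \<bullet> v)" if "G \<in> star v" for G
      using that t(2)[OF that] t(3) up by (cases "G = F") auto
    ultimately show "l \<bullet> v \<le> l \<bullet> x" by (simp add: sum_nonneg)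
  qed
qed

lemma two_face_lowest_vertex:
  assumes F: "F \<in> two_faces P" and inj: "inj_on ((\<bullet>) l) (vertices P)"
  shows "\<exists>!v. v \<in> vertices P \<and> v \<in> F \<and> (\<forall>x\<in>F. l \<bullet> v \<le> l \<bullet> x)"
proof -
  let ?V = "vertices P \<inter> F"
  have "?V \<noteq> {}" "finite ?V" using two_face_has_vertex[OF F] finite_vertices by auto
  then obtain v where v: "v \<in> ?V" "\<And>x. x \<in> ?V \<Longrightarrow> l \<bullet> v \<le> l \<bullet> x"
    using finite_lowest[where f = "(\<bullet>) l"] by metis
  have "convex hull ?V \<subseteq> {x. l \<bullet> v \<le> l \<bullet> x}"
    using v(2) by (intro hull_minimal) (auto simp: convex_halfspace_ge)
  then have low: "\<forall>x\<in>F. l \<bullet> v \<le> l \<bullet> x" using two_face_eq_hull[OF F] by blast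
  show ?thesis
  proof (rule ex1I[of _ v])
    show "v \<in> vertices P \<and> v \<in> F \<and> (\<forall>x\<in>F. l \<bullet> v \<le> l \<bullet> x)" using v(1) low by auto
  next
    fix u assume u: "u \<in> vertices P \<and> u \<in> F \<and> (\<forall>x\<in>F. l \<bullet> u \<le> l \<bullet> x)"
    then have "l \<bullet> u = l \<bullet> v" using low v(1) by (meson Int_iff order_antisym)
    then show "u = v" using inj u v(1) by (auto dest: inj_onD)
  qed
qed

text \<open>
  Each face is counted once, at its lowest vertex.
\<close>

lemma sum_card_lowest:
  assumes inj: "inj_on ((\<bullet>) l) (vertices P)"
  shows "(\<Sum>v\<in>vertices P. card {F \<in> star v. star v - {F} \<subseteq> {G \<in> star v. l \<bullet> v < l \<bullet> nb v G}})
    = card (two_faces P)"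
proof -
  define m where "m F = (THE v. v \<in> vertices P \<and> v \<in> F \<and> (\<forall>x\<in>F. l \<bullet> v \<le> l \<bullet> x))" for F
  have m: "m F \<in> vertices P \<and> m F \<in> F \<and> (\<forall>x\<in>F. l \<bullet> m F \<le> l \<bullet> x)" if "F \<in> two_faces P" for F
    unfolding m_def by (rule theI'[OF two_face_lowest_vertex[OF that inj]])
  have m_eq: "m F = v" if "F \<in> two_faces P" "v \<in> vertices P" "v \<in> F" "\<forall>x\<in>F. l \<bullet> v \<le> l \<bullet> x" for F v
    using two_face_lowest_vertex[OF that(1) inj] m[OF that(1)] that by blast
  have "{F \<in> star v. star v - {F} \<subseteq> {G \<in> star v. l \<bullet> v < l \<bullet> nb v G}} = {F \<in> two_faces P. m F = v}"
    if v: "v \<in> vertices P" for v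
  proof -
    have "{F \<in> star v. star v - {F} \<subseteq> {G \<in> star v. l \<bullet> v < l \<bullet> nb v G}} = {F \<in> star v. \<forall>x\<in>F. l \<bullet> v \<le> l \<bullet> x}"
      using lowest_in_face_iff[OF v _ inj] by blast
    also have "\<dots> = {F \<in> two_faces P. m F = v}"
      using m m_eq v by (auto simp: star_def)
    finally show ?thesis .
  qed
  then have "(\<Sum>v\<in>vertices P. card {F \<in> star v. star v - {F} \<subseteq> {G \<in> star v. l \<bullet> v < l \<bullet> nb v G}})
    = (\<Sum>v\<in>vertices P. \<Sum>F | F \<in> two_faces P \<and> m F = v. 1)"
    by (intro sum.cong) auto
  also have "\<dots> = (\<Sum>F\<in>two_faces P. 1)"
    using finite_two_faces finite_vertices m by (intro sum.group) auto
  finally show ?thesis by simp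
qed

lemma lowest_iff_all_up:
  assumes v: "v \<in> vertices P" and inj: "inj_on ((\<bullet>) l) (vertices P)"
  shows "(\<forall>u\<in>vertices P. l \<bullet> v \<le> l \<bullet> u) \<longleftrightarrow> star v = {G \<in> star v. l \<bullet> v < l \<bullet> nb v G}"
proof
  assume low: "\<forall>u\<in>vertices P. l \<bullet> v \<le> l \<bullet> u"
  have "l \<bullet> v < l \<bullet> nb v G" if G: "G \<in> star v" for G
  proof -
    have "l \<bullet> v \<noteq> l \<bullet> nb v G"
      using inj_onD[OF inj _ v nb(1)[OF v G]] nb_neq[OF v G] by auto
    moreover have "l \<bullet> v \<le> l \<bullet> nb v G" using low nb(1)[OF v G] by blast
    ultimately show ?thesis by simp
  qed
  then show "star v = {G \<in> star v. l \<bullet> v < l \<bullet> nb v G}" by auto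
next
  assume up: "star v = {G \<in> star v. l \<bullet> v < l \<bullet> nb v G}"
  have "\<not> l \<bullet> u < l \<bullet> v" if "u \<in> vertices P" for u
  proof
    assume "l \<bullet> u < l \<bullet> v"
    moreover have "u \<in> P" using that by (simp add: vertices_def extreme_point_of_def)
    ultimately obtain F where "F \<in> star v" "l \<bullet> nb v F < l \<bullet> v"
      using descending_neighbour[OF v] by blast
    moreover from this(1) have "l \<bullet> v < l \<bullet> nb v F" by (subst (asm) up) blast
    ultimately show False by simp
  qed
  then show "\<forall>u\<in>vertices P. l \<bullet> v \<le> l \<bullet> u" by (meson not_less)
qed

lemma sum_lowest:
  assumes inj: "inj_on ((\<bullet>) l) (vertices P)"
  shows "(\<Sum>v\<in>vertices P. if star v = {G \<in> star v. l \<bullet> v < l \<bullet> nb v G} then 2 else 0) = (2::nat)"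
proof -
  have "vertices P \<noteq> {}"
    using polytope_vertex_exists[OF polytope] aff_dim unfolding vertices_def by fastforce
  then obtain v where v: "v \<in> vertices P" "\<And>x. x \<in> vertices P \<Longrightarrow> l \<bullet> v \<le> l \<bullet> x"
    using finite_lowest[OF finite_vertices, where f = "(\<bullet>) l"] by metis
  have "(star u = {G \<in> star u. l \<bullet> u < l \<bullet> nb u G}) = (u = v)" if u: "u \<in> vertices P" for u
  proof -
    have "(\<forall>x\<in>vertices P. l \<bullet> u \<le> l \<bullet> x) \<longleftrightarrow> u = v"
      using inj_onD[OF inj _ u v(1)] v u by (meson order_antisym)
    then show ?thesis using lowest_iff_all_up[OF u inj] by simp
  qed
  then have "(\<Sum>v\<in>vertices P. if star v = {G \<in> star v. l \<bullet> v < l \<bullet> nb v G} then 2 else 0)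
    = (\<Sum>u\<in>vertices P. if u = v then 2 else (0::nat))" by (intro sum.cong if_cong) simp_all
  then show ?thesis using v(1) finite_vertices by simp
qed

text \<open>
  The numbers of 2-subsets of \<open>U\<close> and of its complement, a 2-subset of \<open>X\<close> being the complement of a
  point. By pigeonhole there is exactly one such subset unless \<open>U\<close> is empty or everything, when
  there are three.
\<close>

lemma card_three_split:
  assumes "card X = 3" "U \<subseteq> X"
  shows "card {x \<in> X. X - {x} \<subseteq> U} + card {x \<in> X. X - {x} \<subseteq> X - U}
    = 1 + (if X = U then 2 else 0) + (if X = X - U then 2 else 0)"
proof -
  obtain x y z where X: "X = {x, y, z}" "x \<noteq> y" "y \<noteq> z" "x \<noteq> z"
    using assms(1) by (auto simp: card_3_iff)
  have c: "{w \<in> X. Q w} = (if Q x then {x} else {}) \<union> (if Q y then {y} else {}) \<union> (if Q z then {z} else {})" for Q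
    unfolding X(1) by auto
  have "U = (if x \<in> U then {x} else {}) \<union> (if y \<in> U then {y} else {}) \<union> (if z \<in> U then {z} else {})"
    using assms(2) X(1) by auto
  moreover have "X - {x} = {y, z}" "X - {y} = {x, z}" "X - {z} = {x, y}" using X by auto
  ultimately show ?thesis
    unfolding c
    by (cases "x \<in> U"; cases "y \<in> U"; cases "z \<in> U") (use X in \<open>auto simp: card_insert_if\<close>)
qed

text \<open>
  Count the faces by their lowest and by their highest vertices. A vertex with upward and downward
  edges contributes exactly one face to the two counts together; only the global minimum and the
  global maximum contribute three. Hence twice the number of faces is the number of vertices plus four.
\<close>

theorem card_two_faces: "2 * card (two_faces P) = card (vertices P) + 4"
proof -
  obtain l where l: "inj_on ((\<bullet>) l) (vertices P)" using exists_inner_inj_on[OF finite_vertices] .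
  have l': "inj_on ((\<bullet>) (- l)) (vertices P)" using l by (auto simp: inj_on_def)
  let ?U = "\<lambda>l v. {G \<in> star v. l \<bullet> v < l \<bullet> nb v G}"
  \<comment> \<open>No edge is level, so the edges that go up for \<open>- l\<close> are those that do not for \<open>l\<close>.\<close>
  have U: "?U (- l) v = star v - ?U l v" if v: "v \<in> vertices P" for v
    using inj_onD[OF l _ v nb(1)[OF v]] nb_neq[OF v] by force
  have "2 * card (two_faces P) = (\<Sum>v\<in>vertices P. card {F \<in> star v. star v - {F} \<subseteq> ?U l v}
      + card {F \<in> star v. star v - {F} \<subseteq> ?U (- l) v})"
    by (simp only: sum.distrib sum_card_lowest[OF l] sum_card_lowest[OF l'])
  also have "\<dots> = (\<Sum>v\<in>vertices P. 1 + (if star v = ?U l v then 2 else 0) + (if star v = ?U (- l) v then 2 else 0))"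
  proof (rule sum.cong)
    fix v assume v: "v \<in> vertices P"
    show "card {F \<in> star v. star v - {F} \<subseteq> ?U l v} + card {F \<in> star v. star v - {F} \<subseteq> ?U (- l) v}
      = 1 + (if star v = ?U l v then 2 else 0) + (if star v = ?U (- l) v then 2 else 0)"
      unfolding U[OF v] by (rule card_three_split[OF card_star[OF v]]) auto
  qed simp
  also have "\<dots> = card (vertices P) + 4"
    by (simp only: sum.distrib sum_lowest[OF l] sum_lowest[OF l']) simp
  finally show ?thesis .
qed

end

section \<open>Affine relations and the faces of a convex hull\<close>

definition affine_rel :: "'a::real_vector set \<Rightarrow> ('a \<Rightarrow> real) \<Rightarrow> bool" where
  "affine_rel S r \<longleftrightarrow> sum r S = 0 \<and> (\<Sum>x\<in>S. r x *\<^sub>R x) = 0"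

lemma affine_rel_inner:
  assumes "affine_rel S r"
  shows "(\<Sum>x\<in>S. r x * (a \<bullet> x - b)) = 0"
proof -
  have "(\<Sum>x\<in>S. r x * (a \<bullet> x - b)) = a \<bullet> (\<Sum>x\<in>S. r x *\<^sub>R x) - sum r S * b"
    by (simp add: inner_sum_right right_diff_distrib sum_subtractf sum_distrib_right)
  then show ?thesis using assms by (simp add: affine_rel_def)
qed

lemma affine_rel_uminus: "affine_rel S r \<Longrightarrow> affine_rel S (\<lambda>x. - r x)"
  by (simp add: affine_rel_def sum_negf)

lemma affine_rel_mono:
  assumes "finite S" "T \<subseteq> S" "\<And>x. x \<in> S - T \<Longrightarrow> r x = 0"
  shows "affine_rel S r \<longleftrightarrow> affine_rel T r"
proof -
  have "sum r S = sum r T" "(\<Sum>x\<in>S. r x *\<^sub>R x) = (\<Sum>x\<in>T. r x *\<^sub>R x)"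
    using assms by (auto intro!: sum.mono_neutral_right)
  then show ?thesis by (simp add: affine_rel_def)
qed

lemma affine_independent_iff_rel:
  assumes "finite S" "J \<subseteq> S"
  shows "\<not> affine_dependent J \<longleftrightarrow>
    (\<forall>r. affine_rel S r \<and> (\<forall>x\<in>S - J. r x = 0) \<longrightarrow> (\<forall>x\<in>J. r x = 0))"
proof -
  have dep: "affine_dependent J \<longleftrightarrow> (\<exists>r. affine_rel J r \<and> (\<exists>x\<in>J. r x \<noteq> 0))"
    using affine_dependent_explicit_finite[OF finite_subset[OF assms(2,1)]]
    unfolding affine_rel_def by blast
  have ext: "\<exists>r'. affine_rel S r' \<and> (\<forall>x\<in>S - J. r' x = 0) \<and> (\<forall>x\<in>J. r' x = r x)"
    if "affine_rel J r" for r
  proof (intro exI[of _ "\<lambda>x. if x \<in> J then r x else 0"] conjI)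
    have "affine_rel J (\<lambda>x. if x \<in> J then r x else 0)"
      using that by (simp add: affine_rel_def if_distrib[of "\<lambda>c. c *\<^sub>R _"] cong: if_cong sum.cong)
    then show "affine_rel S (\<lambda>x. if x \<in> J then r x else 0)"
      using assms by (subst affine_rel_mono[of S J]) auto
  qed auto
  have restr: "affine_rel J r" if "affine_rel S r" "\<forall>x\<in>S - J. r x = 0" for r
    using that affine_rel_mono[OF assms] by blast
  show ?thesis
  proof
    assume "\<not> affine_dependent J"
    then show "\<forall>r. affine_rel S r \<and> (\<forall>x\<in>S - J. r x = 0) \<longrightarrow> (\<forall>x\<in>J. r x = 0)"
      using dep restr by blast
  next
    assume R: "\<forall>r. affine_rel S r \<and> (\<forall>x\<in>S - J. r x = 0) \<longrightarrow> (\<forall>x\<in>J. r x = 0)"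
    show "\<not> affine_dependent J"
    proof
      assume "affine_dependent J"
      then obtain r x where r: "affine_rel J r" "x \<in> J" "r x \<noteq> 0" using dep by blast
      obtain r' where "affine_rel S r'" "\<forall>x\<in>S - J. r' x = 0" "\<forall>x\<in>J. r' x = r x"
        using ext[OF r(1)] by blast
      then show False using R r(2,3) by force
    qed
  qed
qed

lemma affine_rel_imp_mem_affine_hull:
  assumes "finite S" "affine_rel S r" "x \<in> S" "r x \<noteq> 0"
  shows "x \<in> affine hull (S - {x})"
proof -
  define q where "q y = - r y / r x" for y
  have "r x + sum r (S - {x}) = 0" "r x *\<^sub>R x + (\<Sum>y\<in>S - {x}. r y *\<^sub>R y) = 0"
    using assms(2) sum.remove[OF assms(1,3), of r] sum.remove[OF assms(1,3), of "\<lambda>y. r y *\<^sub>R y"]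
    by (auto simp: affine_rel_def)
  then have s: "sum r (S - {x}) = - r x" "(\<Sum>y\<in>S - {x}. r y *\<^sub>R y) = - (r x *\<^sub>R x)"
    by (auto simp: eq_neg_iff_add_eq_0 add.commute)
  have "sum q (S - {x}) = (- 1 / r x) * sum r (S - {x})"
    unfolding sum_distrib_left by (intro sum.cong) (auto simp: q_def)
  then have "sum q (S - {x}) = 1" using s(1) assms(4) by simp
  moreover have "(\<Sum>y\<in>S - {x}. q y *\<^sub>R y) = (- 1 / r x) *\<^sub>R (\<Sum>y\<in>S - {x}. r y *\<^sub>R y)"
    unfolding scaleR_sum_right by (intro sum.cong) (auto simp: q_def)
  then have "(\<Sum>y\<in>S - {x}. q y *\<^sub>R y) = x" unfolding s(2) using assms(4) by simp
  ultimately show ?thesis using assms(1) by (subst affine_hull_finite) auto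
qed

lemma aff_dim_remove_rel:
  fixes S :: "'a::euclidean_space set"
  assumes "finite S" "affine_rel S r" "x \<in> S" "r x \<noteq> 0"
  shows "aff_dim (S - {x}) = aff_dim S"
proof -
  have "aff_dim (insert x (S - {x})) = aff_dim (S - {x})"
    using affine_rel_imp_mem_affine_hull[OF assms] by (simp only: aff_dim_insert if_True)
  then show ?thesis using assms(3) by (simp add: insert_absorb)
qed

text \<open>
  Faces of a convex hull of finitely many points are represented by the points that they contain.
  The last conjunct makes the representing set unique even when some of the points are not vertices.
\<close>

definition face_set :: "'a::euclidean_space set \<Rightarrow> 'a set \<Rightarrow> bool" where
  "face_set S J \<longleftrightarrow> J \<subseteq> S \<and> convex hull J face_of convex hull S \<and> convex hull J \<inter> S = J"

lemma face_Int_hull: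
  fixes S :: "'a::euclidean_space set"
  assumes "finite S" "F face_of convex hull S"
  shows "convex hull (F \<inter> S) = F"
proof -
  obtain S' where S': "S' \<subseteq> S" "F = convex hull S'"
    using face_of_convex_hull_subset[OF finite_imp_compact[OF assms(1)] assms(2)] .
  have "S' \<subseteq> F \<inter> S" using S' hull_subset by fast
  then have "F \<subseteq> convex hull (F \<inter> S)" unfolding S'(2) by (rule hull_mono)
  moreover have "convex hull (F \<inter> S) \<subseteq> F"
    using face_of_imp_convex[OF assms(2)] by (intro hull_minimal) auto
  ultimately show ?thesis by blast
qed

lemma face_set_Int:
  assumes "finite S" "F face_of convex hull S"
  shows "face_set S (F \<inter> S)"
  using face_Int_hull[OF assms] assms(2) by (auto simp: face_set_def)

text \<open>
  Gale's criterion. If \<open>J\<close> spans a face, pairing a relation with a functional that exposes the face gives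
  a sum of terms of one sign, one for each point outside \<open>J\<close>. If it does not, then the affine hull of
  \<open>J\<close> meets the convex hull of the other points, and writing a common point in both ways yields a
  relation that is nonnegative but not zero outside \<open>J\<close>.
\<close>

lemma face_set_iff:
  assumes S: "finite S" and J: "J \<subseteq> S"
  shows "face_set S J \<longleftrightarrow>
    (\<forall>r. affine_rel S r \<and> (\<forall>x\<in>S - J. 0 \<le> r x) \<longrightarrow> (\<forall>x\<in>S - J. r x = 0))"
proof
  assume face: "face_set S J"
  show "\<forall>r. affine_rel S r \<and> (\<forall>x\<in>S - J. 0 \<le> r x) \<longrightarrow> (\<forall>x\<in>S - J. r x = 0)"
  proof (intro allI impI, elim conjE)
    fix r assume r: "affine_rel S r" "\<forall>x\<in>S - J. 0 \<le> r x"
    have "polyhedron (convex hull S)"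
      using polytope_imp_polyhedron polytope_convex_hull[OF S] by blast
    then obtain a b where ab: "convex hull S \<subseteq> {x. a \<bullet> x \<le> b}"
      "convex hull J = convex hull S \<inter> {x. a \<bullet> x = b}"
      using exposed_face_of_polyhedron[of "convex hull S" "convex hull J"] face
      unfolding face_set_def exposed_face_of_def by auto
    have SJ: "a \<bullet> x - b < 0" if "x \<in> S - J" for x
    proof -
      have "x \<in> convex hull S" "x \<notin> convex hull J"
        using that face hull_inc[of x S] by (auto simp: face_set_def)
      then have "a \<bullet> x \<le> b" "a \<bullet> x \<noteq> b" using ab by auto
      then show ?thesis by simp
    qed
    have J0: "a \<bullet> x - b = 0" if "x \<in> J" for x
    proof -
      have "x \<in> convex hull J" using that by (rule hull_inc)
      then show ?thesis unfolding ab(2) by simp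
    qed
    have "(\<Sum>x\<in>S - J. - (r x * (a \<bullet> x - b))) = - (\<Sum>x\<in>S. r x * (a \<bullet> x - b))"
      unfolding sum_negf using S J J0 by (intro arg_cong[of _ _ uminus] sum.mono_neutral_left) auto
    also have "\<dots> = 0" using affine_rel_inner[OF r(1)] by simp
    finally have "\<forall>x\<in>S - J. - (r x * (a \<bullet> x - b)) = 0"
      using r(2) SJ S by (subst (asm) sum_nonneg_eq_0_iff) (auto simp: mult_nonneg_nonpos less_imp_le)
    then show "\<forall>x\<in>S - J. r x = 0" using SJ by fastforce
  qed
next
  assume crit: "\<forall>r. affine_rel S r \<and> (\<forall>x\<in>S - J. 0 \<le> r x) \<longrightarrow> (\<forall>x\<in>S - J. r x = 0)"
  have finJ: "finite J" using finite_subset[OF J S] .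
  have disj: "affine hull J \<inter> convex hull (S - J) = {}"
  proof (rule ccontr)
    assume "affine hull J \<inter> convex hull (S - J) \<noteq> {}"
    then obtain z where z: "z \<in> affine hull J" "z \<in> convex hull (S - J)" by blast
    obtain p where p: "sum p J = 1" "(\<Sum>x\<in>J. p x *\<^sub>R x) = z"
      using z(1) affine_hull_finite[OF finJ] by auto
    obtain q where q: "\<forall>x\<in>S - J. 0 \<le> q x" "sum q (S - J) = 1" "(\<Sum>x\<in>S - J. q x *\<^sub>R x) = z"
      using z(2) convex_hull_finite[of "S - J"] S by auto
    define r where "r x = (if x \<in> J then - p x else q x)" for x
    have split: "sum f S = sum f (S - J) + sum f J" for f :: "'a \<Rightarrow> 'c::comm_monoid_add"
      using sum.subset_diff[OF J S] .
    have "affine_rel S r"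
      unfolding affine_rel_def split by (simp add: r_def p q sum_negf)
    moreover have "\<forall>x\<in>S - J. 0 \<le> r x" using q(1) by (simp add: r_def)
    ultimately have "\<forall>x\<in>S - J. r x = 0" using crit by blast
    then have "sum q (S - J) = 0" by (simp add: r_def)
    then show False using q(2) by simp
  qed
  have "convex hull J face_of convex hull S" by (rule face_of_convex_hulls[OF S J disj])
  moreover have "convex hull J \<inter> S = J"
  proof -
    have "x \<in> J" if "x \<in> convex hull J" "x \<in> S" for x
      using that disj hull_inc[of x "S - J"] convex_hull_subset_affine_hull[of J] by blast
    then show ?thesis using J hull_inc by fast
  qed
  ultimately show "face_set S J" using J by (simp add: face_set_def)
qed

lemma face_set_whole: "face_set S S"
proof -
  have "convex hull S \<inter> S = S" using hull_subset by fast
  then show ?thesis by (simp add: face_set_def face_of_refl)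
qed

lemma extreme_point_if_face_set:
  assumes "face_set S {x}"
  shows "x extreme_point_of convex hull S"
  using assms by (simp add: face_set_def face_of_singleton)

lemma face_set_subset_iff:
  assumes "face_set S J" "face_set S J'"
  shows "convex hull J \<subseteq> convex hull J' \<longleftrightarrow> J \<subseteq> J'"
  using assms hull_mono[of J J' convex] unfolding face_set_def by blast

lemma vertices_face_set:
  assumes "\<And>x. x \<in> S \<Longrightarrow> face_set S {x}" "face_set S J"
  shows "vertices (convex hull J) = J"
proof
  show "vertices (convex hull J) \<subseteq> J"
    unfolding vertices_def by (rule extreme_points_of_convex_hull)
  show "J \<subseteq> vertices (convex hull J)"
  proof
    fix x assume x: "x \<in> J"
    then have "x \<in> S" using assms(2) by (auto simp: face_set_def)
    then have "x extreme_point_of convex hull S" using assms(1) extreme_point_if_face_set by blast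
    then show "x \<in> vertices (convex hull J)"
      using x assms(2) extreme_point_of_face hull_inc[of x J]
      unfolding vertices_def face_set_def by blast
  qed
qed

lemma is_simplex_hull_iff:
  assumes "vertices (convex hull J) = J"
  shows "is_simplex (convex hull J) \<longleftrightarrow> \<not> affine_dependent J"
proof
  assume "is_simplex (convex hull J)"
  then obtain C where C: "\<not> affine_dependent C" "convex hull J = convex hull C"
    unfolding is_simplex_def simplex_def by blast
  then have "vertices (convex hull J) = C"
    unfolding vertices_def by (simp add: extreme_point_of_convex_hull_affine_independent)
  then show "\<not> affine_dependent J" using assms C by simp
next
  assume J: "\<not> affine_dependent J"
  then have "(int (card J) - 1) simplex (convex hull J)" unfolding simplex_def by auto
  then show "is_simplex (convex hull J)" unfolding is_simplex_def by blast
qed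

lemma facet_maximal:
  assumes "convex K" "F facet_of K" "G face_of K" "F \<subseteq> G" "G \<noteq> K"
  shows "F = G"
proof (rule ccontr)
  assume "F \<noteq> G"
  moreover have "F face_of G"
    using assms face_of_face facet_of_imp_face_of by blast
  ultimately have "aff_dim F < aff_dim G"
    using face_of_aff_dim_lt face_of_imp_convex assms(3) by blast
  moreover have "aff_dim G < aff_dim K" using face_of_aff_dim_lt assms by blast
  ultimately show False using assms(2) by (simp add: facet_of_def)
qed

text \<open>
  Faces are ordered like the sets of points that represent them, so a bijection of the points
  that respects these sets induces an isomorphism of the face lattices.
\<close>

lemma comb_equiv_if_face_sets:
  fixes S :: "'a::euclidean_space set" and S' :: "'b::euclidean_space set"
  assumes fin: "finite S" "finite S'" and f: "bij_betw f S S'"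
    and iff: "\<And>J. J \<subseteq> S \<Longrightarrow> face_set S J \<longleftrightarrow> face_set S' (f ` J)"
  shows "comb_equiv (convex hull S) (convex hull S')"
proof -
  define \<phi> where "\<phi> F = convex hull (f ` (F \<inter> S))" for F
  have fs: "face_set S (F \<inter> S)" if "F face_of convex hull S" for F using face_set_Int[OF fin(1) that] .
  have fs': "face_set S' (f ` (F \<inter> S))" if "F face_of convex hull S" for F
    using fs[OF that] iff[of "F \<inter> S"] by blast
  have ord: "F \<subseteq> F' \<longleftrightarrow> \<phi> F \<subseteq> \<phi> F'"
    if F: "F face_of convex hull S" and F': "F' face_of convex hull S" for F F'
  proof -
    have "F \<subseteq> F' \<longleftrightarrow> convex hull (F \<inter> S) \<subseteq> convex hull (F' \<inter> S)"
      by (simp only: face_Int_hull[OF fin(1) F] face_Int_hull[OF fin(1) F'])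
    also have "\<dots> \<longleftrightarrow> F \<inter> S \<subseteq> F' \<inter> S" by (rule face_set_subset_iff[OF fs[OF F] fs[OF F']])
    also have "\<dots> \<longleftrightarrow> f ` (F \<inter> S) \<subseteq> f ` (F' \<inter> S)"
      using inj_on_image_subset_iff[OF bij_betw_imp_inj_on[OF f], of "F \<inter> S" "F' \<inter> S"] by simp
    also have "\<dots> \<longleftrightarrow> \<phi> F \<subseteq> \<phi> F'"
      unfolding \<phi>_def by (rule face_set_subset_iff[OF fs'[OF F] fs'[OF F'], symmetric])
    finally show ?thesis .
  qed
  have "bij_betw \<phi> {F. F face_of convex hull S} {G. G face_of convex hull S'}"
  proof (rule bij_betw_imageI)
    show "inj_on \<phi> {F. F face_of convex hull S}"
      using ord by (intro inj_onI) (simp, blast)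
    show "\<phi> ` {F. F face_of convex hull S} = {G. G face_of convex hull S'}"
    proof
      show "\<phi> ` {F. F face_of convex hull S} \<subseteq> {G. G face_of convex hull S'}"
        using fs' by (auto simp: \<phi>_def face_set_def)
      show "{G. G face_of convex hull S'} \<subseteq> \<phi> ` {F. F face_of convex hull S}"
      proof
        fix G assume "G \<in> {G. G face_of convex hull S'}"
        then have G: "G face_of convex hull S'" by simp
        define J where "J = {x \<in> S. f x \<in> G}"
        have img: "f ` J = G \<inter> S'" using bij_betw_imp_surj_on[OF f] by (auto simp: J_def)
        have "face_set S J" using face_set_Int[OF fin(2) G] iff[of J] img by (simp add: J_def)
        then have "convex hull J face_of convex hull S" "convex hull J \<inter> S = J" by (auto simp: face_set_def)
        moreover from this(2) have "\<phi> (convex hull J) = G"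
          unfolding \<phi>_def using img face_Int_hull[OF fin(2) G] by simp
        ultimately show "G \<in> \<phi> ` {F. F face_of convex hull S}" by blast
      qed
    qed
  qed
  then show ?thesis unfolding comb_equiv_def using ord by blast
qed

text \<open>
  The exposing functional of a facet automatically cuts out its affine hull, because the
  hyperplane section of the affine hull of \<open>Q\<close> has the dimension of the facet.
\<close>

lemma facet_hyperplane:
  assumes Q: "polytope Q" and F: "F facet_of Q"
  obtains a b where "Q \<subseteq> {x. a \<bullet> x \<le> b}" "F = Q \<inter> {x. a \<bullet> x = b}"
    "affine hull F = affine hull Q \<inter> {x. a \<bullet> x = b}" "\<And>x. x \<in> rel_interior Q \<Longrightarrow> a \<bullet> x < b"
proof -
  obtain a b where ab: "Q \<subseteq> {x. a \<bullet> x \<le> b}" "F = Q \<inter> {x. a \<bullet> x = b}"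
    using exposed_face_of_polyhedron[OF polytope_imp_polyhedron[OF Q]] facet_of_imp_face_of[OF F]
    unfolding exposed_face_of_def by blast
  let ?H = "affine hull Q \<inter> {x. a \<bullet> x = b}"
  have ne: "F \<noteq> {}" "F \<noteq> Q" and dim: "aff_dim F = aff_dim Q - 1" using F by (auto simp: facet_of_def)
  have sub: "F \<subseteq> ?H" unfolding ab(2) using hull_subset[of Q affine] by blast
  have "\<not> affine hull Q \<subseteq> {x. a \<bullet> x = b}"
    using ne(2) ab(2) hull_subset[of Q affine] by blast
  moreover have "?H \<noteq> {}" using sub ne(1) by blast
  ultimately have "aff_dim ?H = aff_dim F"
    using aff_dim_affine_Int_hyperplane[of "affine hull Q" a b] dim by simp
  then have "affine hull F = affine hull ?H" using aff_dim_eq_full_gen[OF sub] by simp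
  also have "\<dots> = ?H" by (simp add: affine_hyperplane affine_Int)
  finally have "affine hull F = ?H" .
  moreover have "a \<bullet> x < b" if "x \<in> rel_interior Q" for x
  proof -
    have "x \<notin> F" using that face_of_disjoint_rel_interior[OF facet_of_imp_face_of[OF F] ne(2)] by blast
    moreover have "x \<in> Q" using that rel_interior_subset by blast
    ultimately have "a \<bullet> x \<le> b" "a \<bullet> x \<noteq> b" using ab by blast+
    then show ?thesis by simp
  qed
  ultimately show ?thesis using that ab by blast
qed

section \<open>Point sets with a single circuit\<close>

text \<open>
  All relations are multiples of one circuit, and \<open>B\<close>, \<open>C\<close> are the two sides of its Radon
  partition. The convex hull is then an iterated pyramid with apexes \<open>A\<close> over the hull of
  \<open>B \<union> C\<close>. The bounds on the cardinalities ensure that every point is a vertex.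
\<close>

definition radon_config :: "'a::euclidean_space set \<Rightarrow> 'a set \<Rightarrow> 'a set \<Rightarrow> bool" where
  "radon_config A B C \<longleftrightarrow> finite A \<and> finite B \<and> finite C \<and> A \<inter> B = {} \<and> A \<inter> C = {} \<and> B \<inter> C = {} \<and>
    2 \<le> card B \<and> 2 \<le> card C \<and>
    (\<exists>u. affine_rel (A \<union> B \<union> C) u \<and> (\<forall>x\<in>A. u x = 0) \<and> (\<forall>x\<in>B. 0 < u x) \<and> (\<forall>x\<in>C. u x < 0) \<and>
      (\<forall>r. affine_rel (A \<union> B \<union> C) r \<longrightarrow> (\<exists>k. \<forall>x\<in>A \<union> B \<union> C. r x = k * u x)))"

text \<open>
  A multiple of the circuit changes sign unless it vanishes, so it obstructs \<open>J\<close> precisely if \<open>J\<close>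
  contains one side of the partition and misses a point of the other.
\<close>

lemma radon_face_set:
  assumes R: "radon_config A B C" and J: "J \<subseteq> A \<union> B \<union> C"
  shows "face_set (A \<union> B \<union> C) J \<longleftrightarrow> (B \<subseteq> J \<longleftrightarrow> C \<subseteq> J)"
proof -
  let ?S = "A \<union> B \<union> C"
  have fin: "finite ?S" using R by (auto simp: radon_config_def)
  obtain u where u: "affine_rel ?S u" "\<forall>x\<in>A. u x = 0" "\<forall>x\<in>B. 0 < u x" "\<forall>x\<in>C. u x < 0"
    and all: "\<And>r. affine_rel ?S r \<Longrightarrow> \<exists>k. \<forall>x\<in>?S. r x = k * u x"
    using R unfolding radon_config_def by blast
  show ?thesis unfolding face_set_iff[OF fin J]
  proof
    assume *: "\<forall>r. affine_rel ?S r \<and> (\<forall>x\<in>?S - J. 0 \<le> r x) \<longrightarrow> (\<forall>x\<in>?S - J. r x = 0)"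
    show "B \<subseteq> J \<longleftrightarrow> C \<subseteq> J"
    proof
      assume BJ: "B \<subseteq> J"
      have "\<forall>x\<in>?S - J. 0 \<le> - u x" using BJ u(2,4) by fastforce
      then have "\<forall>x\<in>?S - J. - u x = 0"
        using spec[OF *, of "\<lambda>x. - u x"] affine_rel_uminus[OF u(1)] by blast
      then have "x \<in> J" if "x \<in> C" for x using that u(4) by force
      then show "C \<subseteq> J" by blast
    next
      assume CJ: "C \<subseteq> J"
      have "\<forall>x\<in>?S - J. 0 \<le> u x" using CJ u(2,3) by fastforce
      then have "\<forall>x\<in>?S - J. u x = 0" using spec[OF *, of u] u(1) by blast
      then have "x \<in> J" if "x \<in> B" for x using that u(3) by force
      then show "B \<subseteq> J" by blast
    qed
  next
    assume iff: "B \<subseteq> J \<longleftrightarrow> C \<subseteq> J"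
    show "\<forall>r. affine_rel ?S r \<and> (\<forall>x\<in>?S - J. 0 \<le> r x) \<longrightarrow> (\<forall>x\<in>?S - J. r x = 0)"
    proof (intro allI impI, elim conjE)
      fix r assume r: "affine_rel ?S r" "\<forall>x\<in>?S - J. 0 \<le> r x"
      obtain k where k: "\<forall>x\<in>?S. r x = k * u x" using all[OF r(1)] by blast
      show "\<forall>x\<in>?S - J. r x = 0"
      proof (cases "B \<subseteq> J")
        case True
        then show ?thesis using iff u(2) k by auto
      next
        case False
        then obtain b c where bc: "b \<in> B - J" "c \<in> C - J" using iff by blast
        have "0 \<le> k * u b" "0 \<le> k * u c" using r(2) k bc by auto
        moreover have "0 < u b" "u c < 0" using u bc by auto
        ultimately have "k = 0" by (auto simp: zero_le_mult_iff)
        then show ?thesis using k by auto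
      qed
    qed
  qed
qed

lemma radon_affine_dependent_iff:
  assumes R: "radon_config A B C" and J: "J \<subseteq> A \<union> B \<union> C"
  shows "affine_dependent J \<longleftrightarrow> B \<union> C \<subseteq> J"
proof -
  let ?S = "A \<union> B \<union> C"
  have fin: "finite ?S" using R by (auto simp: radon_config_def)
  obtain u where u: "affine_rel ?S u" "\<forall>x\<in>A. u x = 0" "\<forall>x\<in>B. 0 < u x" "\<forall>x\<in>C. u x < 0"
    and all: "\<And>r. affine_rel ?S r \<Longrightarrow> \<exists>k. \<forall>x\<in>?S. r x = k * u x"
    using R unfolding radon_config_def by blast
  have "B \<noteq> {}" using R by (auto simp: radon_config_def)
  have "\<not> affine_dependent J \<longleftrightarrow> \<not> B \<union> C \<subseteq> J"
    unfolding affine_independent_iff_rel[OF fin J]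
  proof
    assume *: "\<forall>r. affine_rel ?S r \<and> (\<forall>x\<in>?S - J. r x = 0) \<longrightarrow> (\<forall>x\<in>J. r x = 0)"
    show "\<not> B \<union> C \<subseteq> J"
    proof
      assume BC: "B \<union> C \<subseteq> J"
      then have "\<forall>x\<in>?S - J. u x = 0" using u(2) by auto
      then have "\<forall>x\<in>J. u x = 0" using * u(1) by blast
      then show False using \<open>B \<noteq> {}\<close> BC u(3) by force
    qed
  next
    assume "\<not> B \<union> C \<subseteq> J"
    then obtain y where y: "y \<in> B \<union> C" "y \<notin> J" by blast
    show "\<forall>r. affine_rel ?S r \<and> (\<forall>x\<in>?S - J. r x = 0) \<longrightarrow> (\<forall>x\<in>J. r x = 0)"
    proof (intro allI impI, elim conjE)
      fix r assume r: "affine_rel ?S r" "\<forall>x\<in>?S - J. r x = 0"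
      obtain k where k: "\<forall>x\<in>?S. r x = k * u x" using all[OF r(1)] by blast
      have "k * u y = 0" "u y \<noteq> 0" using r(2) k y u by fastforce+
      then show "\<forall>x\<in>J. r x = 0" using k J by auto
    qed
  qed
  then show ?thesis by blast
qed

lemma radon_singleton_face_set:
  assumes R: "radon_config A B C" and x: "x \<in> A \<union> B \<union> C"
  shows "face_set (A \<union> B \<union> C) {x}"
proof -
  have "\<not> B \<subseteq> {x}" "\<not> C \<subseteq> {x}"
    using R card_mono[of "{x}" B] card_mono[of "{x}" C] by (auto simp: radon_config_def)
  then show ?thesis using radon_face_set[OF R, of "{x}"] x by auto
qed

lemma radon_vertices:
  assumes R: "radon_config A B C" and J: "face_set (A \<union> B \<union> C) J"
  shows "vertices (convex hull J) = J"
  by (rule vertices_face_set[OF radon_singleton_face_set[OF R] J])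

lemma radon_comb_equiv:
  fixes A B C :: "'a::euclidean_space set" and A' B' C' :: "'b::euclidean_space set"
  assumes R: "radon_config A B C" and R': "radon_config A' B' C'"
    and c: "card A = card A'" "card B = card B'" "card C = card C'"
  shows "comb_equiv (convex hull (A \<union> B \<union> C)) (convex hull (A' \<union> B' \<union> C'))"
proof -
  have fin: "finite A" "finite B" "finite C" "finite A'" "finite B'" "finite C'"
    and d: "A \<inter> B = {}" "A \<inter> C = {}" "B \<inter> C = {}" and d': "A' \<inter> B' = {}" "A' \<inter> C' = {}" "B' \<inter> C' = {}"
    using R R' by (auto simp: radon_config_def)
  obtain fA fB fC where f: "bij_betw fA A A'" "bij_betw fB B B'" "bij_betw fC C C'"
    using finite_same_card_bij fin c by metis
  define f where "f x = (if x \<in> A then fA x else if x \<in> B then fB x else fC x)" for x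
  have fA: "bij_betw f A A'" using f(1) by (rule bij_betw_cong[THEN iffD1, rotated]) (simp add: f_def)
  have fB: "bij_betw f B B'" using f(2) d by (intro bij_betw_cong[THEN iffD1, OF _ f(2)]) (auto simp: f_def)
  have fC: "bij_betw f C C'" using f(3) d by (intro bij_betw_cong[THEN iffD1, OF _ f(3)]) (auto simp: f_def)
  have fS: "bij_betw f (A \<union> B \<union> C) (A' \<union> B' \<union> C')"
    using d' by (intro bij_betw_combine fA fB fC) auto
  have sub: "f ` X \<subseteq> f ` J \<longleftrightarrow> X \<subseteq> J" if "X \<subseteq> A \<union> B \<union> C" "J \<subseteq> A \<union> B \<union> C" for X J
    using inj_on_image_subset_iff[OF bij_betw_imp_inj_on[OF fS] that] .
  show ?thesis
  proof (rule comb_equiv_if_face_sets[OF _ _ fS])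
    fix J assume J: "J \<subseteq> A \<union> B \<union> C"
    have "f ` J \<subseteq> A' \<union> B' \<union> C'" using J bij_betw_imp_surj_on[OF fS] by blast
    then show "face_set (A \<union> B \<union> C) J \<longleftrightarrow> face_set (A' \<union> B' \<union> C') (f ` J)"
      using radon_face_set[OF R J] radon_face_set[OF R'] sub[OF _ J, of B] sub[OF _ J, of C]
        bij_betw_imp_surj_on[OF fB] bij_betw_imp_surj_on[OF fC] by auto
  qed (use fin in auto)
qed

text \<open>
  A simplex does not contain the whole circuit, hence contains neither side of the partition.
  Adding the apexes does not change this, so it yields another proper face, and a facet is maximal
  among these.
\<close>

lemma radon_facet_simplex_imp:
  assumes R: "radon_config A B C" and F: "F facet_of convex hull (A \<union> B \<union> C)" and simplex: "is_simplex F"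
  shows "A \<subseteq> F"
proof -
  let ?S = "A \<union> B \<union> C"
  let ?J = "F \<inter> ?S"
  have fin: "finite ?S" using R by (auto simp: radon_config_def)
  have face: "F face_of convex hull ?S" using F by (rule facet_of_imp_face_of)
  have J: "face_set ?S ?J" using face_set_Int[OF fin face] .
  have hull: "convex hull ?J = F" using face_Int_hull[OF fin face] .
  have "vertices (convex hull ?J) = ?J" by (rule radon_vertices[OF R J])
  then have "\<not> affine_dependent ?J" using is_simplex_hull_iff simplex hull by metis
  then have nBC: "\<not> B \<union> C \<subseteq> ?J" using radon_affine_dependent_iff[OF R, of ?J] by blast
  have "B \<subseteq> ?J \<longleftrightarrow> C \<subseteq> ?J" using J radon_face_set[OF R, of ?J] by blast
  then have n: "\<not> B \<subseteq> ?J" "\<not> C \<subseteq> ?J" using nBC by blast+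
  have d: "A \<inter> B = {}" "A \<inter> C = {}" using R by (auto simp: radon_config_def)
  have n': "\<not> B \<subseteq> ?J \<union> A" "\<not> C \<subseteq> ?J \<union> A" using n d by blast+
  have JA: "face_set ?S (?J \<union> A)" using radon_face_set[OF R, of "?J \<union> A"] n' by blast
  have "F = convex hull (?J \<union> A)"
  proof (rule facet_maximal[OF _ F])
    show "convex hull (?J \<union> A) face_of convex hull ?S" using JA by (simp add: face_set_def)
    show "F \<subseteq> convex hull (?J \<union> A)" using hull_mono[of ?J "?J \<union> A" convex] hull by simp
    show "convex hull (?J \<union> A) \<noteq> convex hull ?S"
    proof
      assume eq: "convex hull (?J \<union> A) = convex hull ?S"
      have "?S \<subseteq> ?J \<union> A" using face_set_subset_iff[OF face_set_whole JA] eq by simp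
      then show False using n' by blast
    qed
  qed simp
  then show ?thesis using hull_subset[of "?J \<union> A" convex] by blast
qed

text \<open>
  No relation involves \<open>a\<close>, so \<open>a\<close> is not an affine combination of the other points.
\<close>

lemma radon_aff_dim_remove_apex:
  assumes R: "radon_config A B C" and a: "a \<in> A"
  shows "aff_dim (A \<union> B \<union> C - {a}) = aff_dim (A \<union> B \<union> C) - 1"
proof -
  let ?S = "A \<union> B \<union> C"
  have fin: "finite ?S" using R by (auto simp: radon_config_def)
  obtain u where u: "affine_rel ?S u" "\<forall>x\<in>A. u x = 0"
    and all: "\<And>r. affine_rel ?S r \<Longrightarrow> \<exists>k. \<forall>x\<in>?S. r x = k * u x"
    using R unfolding radon_config_def by blast
  have "a \<notin> affine hull (?S - {a})"
  proof
    assume "a \<in> affine hull (?S - {a})"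
    then obtain p where p: "sum p (?S - {a}) = 1" "(\<Sum>x\<in>?S - {a}. p x *\<^sub>R x) = a"
      using affine_hull_finite[of "?S - {a}"] fin by auto
    define r where "r x = (if x = a then -1 else p x)" for x
    have "sum r ?S = r a + sum r (?S - {a})"
      using fin a by (intro sum.remove) auto
    moreover have "(\<Sum>x\<in>?S. r x *\<^sub>R x) = r a *\<^sub>R a + (\<Sum>x\<in>?S - {a}. r x *\<^sub>R x)"
      using fin a by (intro sum.remove) auto
    moreover have "sum r (?S - {a}) = sum p (?S - {a})"
      "(\<Sum>x\<in>?S - {a}. r x *\<^sub>R x) = (\<Sum>x\<in>?S - {a}. p x *\<^sub>R x)"
      by (auto simp: r_def intro!: sum.cong)
    ultimately have "affine_rel ?S r" using p by (simp add: affine_rel_def r_def)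
    then obtain k where "\<forall>x\<in>?S. r x = k * u x" using all by blast
    then have "r a = 0" using a u(2) by auto
    then show False by (simp add: r_def)
  qed
  then have "aff_dim (insert a (?S - {a})) = aff_dim (?S - {a}) + 1"
    by (simp only: aff_dim_insert if_False)
  moreover have "insert a (?S - {a}) = ?S" using a by blast
  ultimately show ?thesis by simp
qed

text \<open>
  A facet that is not a simplex contains the circuit and therefore omits an apex; by maximality it
  omits nothing else.
\<close>

lemma radon_nonsimplex_facets:
  assumes R: "radon_config A B C"
  shows "{F. F facet_of convex hull (A \<union> B \<union> C) \<and> \<not> is_simplex F}
    = (\<lambda>a. convex hull (A \<union> B \<union> C - {a})) ` A"
    and "card {F. F facet_of convex hull (A \<union> B \<union> C) \<and> \<not> is_simplex F} = card A"
proof -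
  let ?S = "A \<union> B \<union> C"
  have fin: "finite ?S" and d: "A \<inter> B = {}" "A \<inter> C = {}" and ne: "B \<noteq> {}"
    using R by (auto simp: radon_config_def)
  have fsa: "face_set ?S (?S - {a})" if "a \<in> A" for a
    using radon_face_set[OF R, of "?S - {a}"] that d by blast
  note vert = radon_vertices[OF R]
  show eq: "{F. F facet_of convex hull ?S \<and> \<not> is_simplex F} = (\<lambda>a. convex hull (?S - {a})) ` A"
  proof (intro equalityI subsetI)
    fix F assume "F \<in> {F. F facet_of convex hull ?S \<and> \<not> is_simplex F}"
    then have F: "F facet_of convex hull ?S" and ns: "\<not> is_simplex F" by auto
    let ?J = "F \<inter> ?S"
    have face: "F face_of convex hull ?S" using F by (rule facet_of_imp_face_of)
    have J: "face_set ?S ?J" using face_set_Int[OF fin face] .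
    have hull: "convex hull ?J = F" using face_Int_hull[OF fin face] .
    have "affine_dependent ?J" using is_simplex_hull_iff[OF vert[OF J]] ns hull by metis
    then have BC: "B \<union> C \<subseteq> ?J" using radon_affine_dependent_iff[OF R, of ?J] by blast
    have "F \<noteq> convex hull ?S" using F by auto
    then have "?J \<noteq> ?S" using hull by metis
    then obtain a where a: "a \<in> A" "a \<notin> ?J" using BC by blast
    have "F = convex hull (?S - {a})"
    proof (rule facet_maximal[OF _ F])
      show "convex hull (?S - {a}) face_of convex hull ?S" using fsa[OF a(1)] by (simp add: face_set_def)
      have "?J \<subseteq> ?S - {a}" using a by blast
      then show "F \<subseteq> convex hull (?S - {a})" using hull_mono[of ?J "?S - {a}" convex] hull by simp
      show "convex hull (?S - {a}) \<noteq> convex hull ?S"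
      proof
        assume eq: "convex hull (?S - {a}) = convex hull ?S"
        have "?S \<subseteq> ?S - {a}" using face_set_subset_iff[OF face_set_whole fsa[OF a(1)]] eq by simp
        then show False using a by blast
      qed
    qed simp
    then show "F \<in> (\<lambda>a. convex hull (?S - {a})) ` A" using a by blast
  next
    fix F assume "F \<in> (\<lambda>a. convex hull (?S - {a})) ` A"
    then obtain a where a: "a \<in> A" and F: "F = convex hull (?S - {a})" by blast
    have "B \<subseteq> ?S - {a}" using a d by blast
    then have "F \<noteq> {}" using ne F by auto
    then have "F facet_of convex hull ?S"
      using fsa[OF a] radon_aff_dim_remove_apex[OF R a]
      by (simp add: facet_of_def F face_set_def aff_dim_convex_hull)
    moreover have "\<not> is_simplex F"
      unfolding F is_simplex_hull_iff[OF vert[OF fsa[OF a]]]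
      using radon_affine_dependent_iff[OF R, of "?S - {a}"] a d by blast
    ultimately show "F \<in> {F. F facet_of convex hull ?S \<and> \<not> is_simplex F}" by simp
  qed
  have "inj_on (\<lambda>a. convex hull (?S - {a})) A"
  proof (rule inj_onI)
    fix a b assume a: "a \<in> A" "b \<in> A" and eq: "convex hull (?S - {a}) = convex hull (?S - {b})"
    have "?S - {a} \<subseteq> ?S - {b}" using face_set_subset_iff[OF fsa[OF a(1)] fsa[OF a(2)]] eq by simp
    then show "a = b" using a by blast
  qed
  then show "card {F. F facet_of convex hull ?S \<and> \<not> is_simplex F} = card A"
    unfolding eq by (rule card_image)
qed

text \<open>
  Removing a point of the circuit keeps the affine hull and leaves an affinely independent set.
\<close>

lemma radon_aff_dim:
  assumes R: "radon_config A B C"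
  shows "aff_dim (A \<union> B \<union> C) = int (card A + card B + card C) - 2"
proof -
  let ?S = "A \<union> B \<union> C"
  have fin: "finite A" "finite B" "finite C" and d: "A \<inter> B = {}" "A \<inter> C = {}" "B \<inter> C = {}"
    and ne: "B \<noteq> {}"
    using R by (auto simp: radon_config_def)
  obtain u where u: "affine_rel ?S u" "\<forall>x\<in>B. 0 < u x" using R unfolding radon_config_def by blast
  obtain b where b: "b \<in> B" using ne by blast
  have "u b \<noteq> 0" using u(2) b by force
  then have "aff_dim (?S - {b}) = aff_dim ?S" using aff_dim_remove_rel[OF _ u(1)] fin b by blast
  moreover have "\<not> affine_dependent (?S - {b})"
    using radon_affine_dependent_iff[OF R, of "?S - {b}"] b by blast
  then have "int (card (?S - {b})) = aff_dim (?S - {b}) + 1" by (rule aff_dim_affine_independent)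
  moreover have "card ?S = card A + card B + card C"
    using fin d by (simp add: card_Un_disjoint Int_Un_distrib2)
  then have "int (card (?S - {b})) = int (card A + card B + card C) - 1"
    using b fin card_gt_0_iff[of B] by (simp add: card_Diff_singleton of_nat_diff ne)
  ultimately show ?thesis by simp
qed

section \<open>Pyramids over cyclic polytopes\<close>

text \<open>
  New coordinate directions as apexes: each lies outside the hyperplane orthogonal to it, and that
  hyperplane contains all points before it.
\<close>

lemma fold_pyramid_Basis:
  fixes X :: "'a::euclidean_space set"
  assumes "finite A" "A \<subseteq> Basis" and X: "finite X" "\<And>x a. x \<in> X \<Longrightarrow> a \<in> A \<Longrightarrow> a \<bullet> x = 0"
  shows "aff_dim (A \<union> X) = aff_dim X + int (card A) \<and>
    fold_pyramid (card A) (aff_dim X + int (card A)) (convex hull X) (convex hull (A \<union> X))"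
  using assms
proof (induction A rule: finite_induct)
  case empty
  then show ?case by (simp add: polytope_convex_hull aff_dim_convex_hull)
next
  case (insert a A)
  let ?Y = "A \<union> X"
  have IH: "aff_dim ?Y = aff_dim X + int (card A)"
    "fold_pyramid (card A) (aff_dim X + int (card A)) (convex hull X) (convex hull ?Y)"
    using insert.IH insert.prems by auto
  have "a \<bullet> y = 0" if "y \<in> ?Y" for y
    using that insert.prems insert.hyps(2) inner_not_same_Basis[of a y] by auto
  then have "affine hull ?Y \<subseteq> {x. a \<bullet> x = 0}"
    by (intro hull_minimal) (auto simp: affine_hyperplane)
  moreover have "a \<bullet> a = 1" using insert.prems by simp
  ultimately have a: "a \<notin> affine hull ?Y" by force
  have dim: "aff_dim (insert a ?Y) = aff_dim X + int (card A) + 1"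
    using a IH(1) by (simp only: aff_dim_insert if_False)
  have "pyramid (aff_dim X + int (card A) + 1) (convex hull ?Y) (convex hull (insert a ?Y))"
    unfolding pyramid_def
  proof (intro conjI exI[of _ a])
    show "polytope (convex hull ?Y)" using insert by (intro polytope_convex_hull) auto
    show "a \<notin> affine hull (convex hull ?Y)" using a by simp
    show "convex hull insert a ?Y = convex hull insert a (convex hull ?Y)" by (rule hull_insert)
  qed (simp add: aff_dim_convex_hull IH(1))
  then have "fold_pyramid (Suc (card A)) (aff_dim X + int (card A) + 1) (convex hull X) (convex hull (insert a ?Y))"
    using IH(2) by auto
  then show ?case using dim insert.hyps by (simp add: ac_simps)
qed

definition moment :: "(nat \<Rightarrow> 'a::euclidean_space) \<Rightarrow> nat \<Rightarrow> real \<Rightarrow> 'a" where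
  "moment e d t = (\<Sum>i<d. t ^ (i + 1) *\<^sub>R e i)"

context
  fixes e :: "nat \<Rightarrow> 'a::euclidean_space" and d :: nat
  assumes e: "inj_on e {..<d}" "e ` {..<d} \<subseteq> Basis"
begin

lemma moment_inner: "j < d \<Longrightarrow> e j \<bullet> moment e d t = t ^ (j + 1)"
proof -
  assume j: "j < d"
  have "e j \<bullet> moment e d t = (\<Sum>i<d. t ^ (i + 1) * (e j \<bullet> e i))"
    by (simp add: moment_def inner_sum_right)
  also have "\<dots> = (\<Sum>i<d. if i = j then t ^ (j + 1) else 0)"
  proof (rule sum.cong)
    fix i assume "i \<in> {..<d}"
    then have "e j \<bullet> e i = (if i = j then 1 else 0)"
      using e(2) j inj_onD[OF e(1), of i j] inner_Basis[of "e j" "e i"]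
      by (cases "i = j") (auto simp: image_subset_iff)
    then show "t ^ (i + 1) * (e j \<bullet> e i) = (if i = j then t ^ (j + 1) else 0)" by simp
  qed simp
  also have "\<dots> = t ^ (j + 1)" using j by simp
  finally show ?thesis .
qed

lemma inj_moment: "d > 0 \<Longrightarrow> inj (moment e d)"
  by (rule injI) (metis moment_inner add_0 power_one_right)

text \<open>
  The coordinates of a point of the moment curve are the monomials, so a relation annihilates
  the constants and all powers up to \<open>d\<close>.
\<close>

lemma moment_rel_poly:
  assumes T: "finite T" "d > 0" and r: "affine_rel (moment e d ` T) r" and p: "degree p \<le> d"
  shows "(\<Sum>t\<in>T. r (moment e d t) * poly p t) = 0"
proof -
  have inj: "inj_on (moment e d) T" using inj_moment[OF T(2)] by (rule inj_on_subset) simp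
  have r0: "(\<Sum>t\<in>T. r (moment e d t)) = 0" and r1: "(\<Sum>t\<in>T. r (moment e d t) *\<^sub>R moment e d t) = 0"
    using r by (auto simp: affine_rel_def sum.reindex[OF inj])
  have pow: "(\<Sum>t\<in>T. r (moment e d t) * t ^ k) = 0" if "k \<le> d" for k
  proof (cases k)
    case 0
    then show ?thesis using r0 by simp
  next
    case (Suc j)
    have "0 = e j \<bullet> (\<Sum>t\<in>T. r (moment e d t) *\<^sub>R moment e d t)" using r1 by simp
    also have "\<dots> = (\<Sum>t\<in>T. r (moment e d t) * t ^ k)"
      using Suc that by (simp add: inner_sum_right moment_inner)
    finally show ?thesis by simp
  qed
  have "(\<Sum>t\<in>T. r (moment e d t) * poly p t)
    = (\<Sum>t\<in>T. \<Sum>k\<le>degree p. coeff p k * (r (moment e d t) * t ^ k))"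
    unfolding poly_altdef sum_distrib_left by (intro sum.cong) (auto simp: mult_ac)
  also have "\<dots> = (\<Sum>k\<le>degree p. coeff p k * (\<Sum>t\<in>T. r (moment e d t) * t ^ k))"
    unfolding sum_distrib_left by (rule sum.swap)
  also have "\<dots> = 0" using pow p by simp
  finally show ?thesis .
qed

text \<open>
  Apply the relation to the polynomial that vanishes at all parameters but \<open>a\<close> and \<open>b\<close>; its degree
  is \<open>d\<close>.
\<close>

lemma moment_rel_pair:
  assumes T: "finite T" "d > 0" "card T = d + 2" and r: "affine_rel (moment e d ` T) r"
    and ab: "a \<in> T" "b \<in> T" "a \<noteq> b"
  shows "r (moment e d a) * (\<Prod>s\<in>T - {a, b}. a - s) + r (moment e d b) * (\<Prod>s\<in>T - {a, b}. b - s) = 0"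
proof -
  define p where "p = (\<Prod>s\<in>T - {a, b}. [:- s, 1:])"
  have poly: "poly p t = (\<Prod>s\<in>T - {a, b}. t - s)" for t
    by (simp add: p_def poly_prod)
  have "degree p = card (T - {a, b})"
    unfolding p_def by (subst degree_prod_eq_sum_degree) auto
  also have "\<dots> = d" using T ab by (simp add: card_Diff_subset)
  finally have "(\<Sum>t\<in>T. r (moment e d t) * poly p t) = 0"
    using moment_rel_poly[OF T(1,2) r, of p] by simp
  moreover have "(\<Sum>t\<in>T. r (moment e d t) * poly p t) = (\<Sum>t\<in>{a, b}. r (moment e d t) * poly p t)"
  proof (rule sum.mono_neutral_right)
    show "\<forall>t\<in>T - {a, b}. r (moment e d t) * poly p t = 0"
      unfolding poly using T(1) by (auto intro!: prod_zero)
  qed (use T ab in auto)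
  ultimately show ?thesis using ab(3) by (simp add: poly)
qed

text \<open>
  The points are affinely dependent because there are two more of them than dimensions. By
  \<open>moment_rel_pair\<close> a relation that vanishes at one point vanishes identically, so the relation is unique up to a factor.
  At neighbouring parameters \<open>k\<close> and \<open>k + 1\<close> the two products in \<open>moment_rel_pair\<close> have the
  same sign, since no other parameter lies between; hence the relation alternates, and the sides of the
  partition are the even and the odd parameters.
\<close>

lemma moment_radon_config:
  assumes d: "d + 2 = 2 * m" "2 \<le> m"
  obtains B C where "radon_config {} B C" "card B = m" "card C = m" "B \<union> C = moment e d ` real ` {..<2 * m}"
proof -
  let ?T = "real ` {..<2 * m}"
  let ?g = "\<lambda>k::nat. moment e d (real k)"
  let ?S = "moment e d ` ?T"
  have d0: "d > 0" using d by simp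
  have T: "finite ?T" "card ?T = d + 2" using d by (auto simp: card_image inj_on_of_nat)
  have inj: "inj ?g" using inj_compose[OF inj_moment[OF d0] inj_of_nat] by (simp add: comp_def)
  have S: "?S = ?g ` {..<2 * m}" by (simp add: image_image)
  have cardS: "card ?S = 2 * m" unfolding S using inj by (simp add: card_image inj_on_subset[OF inj])
  have "affine_dependent ?S"
  proof (rule affine_dependent_biggerset_general)
    have "moment e d t \<in> span (e ` {..<d})" for t
      unfolding moment_def by (rule span_sum, rule span_scale, rule span_base) simp
    then have "?S \<subseteq> span (e ` {..<d})" by blast
    then have "dim ?S \<le> card (e ` {..<d})" by (rule dim_le_card) simp
    also have "\<dots> = d" using e(1) by (simp add: card_image)
    finally show "dim ?S + 2 \<le> card ?S" using cardS d by simp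
  qed simp
  then obtain u0 where u0: "affine_rel ?S u0" "\<exists>x\<in>?S. u0 x \<noteq> 0"
    unfolding affine_rel_def using affine_dependent_explicit_finite[of ?S] by auto
  have pair: "r (?g i) * (\<Prod>s\<in>?T - {real i, real j}. real i - s)
      + r (?g j) * (\<Prod>s\<in>?T - {real i, real j}. real j - s) = 0"
    if "affine_rel ?S r" "i < 2 * m" "j < 2 * m" "i \<noteq> j" for r i j
    using moment_rel_pair[OF T(1) d0 T(2) that(1)] that by auto
  have nz: "(\<Prod>s\<in>?T - {real i, real j}. real i - s) \<noteq> 0" for i j by (auto simp: prod_zero_iff)
  have zero: "r (?g j) = 0" if "affine_rel ?S r" "i < 2 * m" "j < 2 * m" "r (?g i) = 0" for r i j
  proof (cases "i = j")
    case False
    then show ?thesis using pair[OF that(1-3)] that(4) nz[of j i] by (simp add: insert_commute)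
  qed (use that in simp)
  have u0nz: "u0 (?g 0) \<noteq> 0"
    using zero[OF u0(1), of 0] u0(2) d unfolding S by auto
  \<comment> \<open>Normalised to be positive at the parameter 0, so that even parameters get positive sign.\<close>
  define u where "u x = u0 x / u0 (?g 0)" for x
  have u: "affine_rel ?S u"
  proof -
    have "u x = (1 / u0 (?g 0)) * u0 x" for x by (simp add: u_def)
    moreover have "affine_rel ?S (\<lambda>x. c * u0 x)" for c
      using u0(1) by (simp add: affine_rel_def flip: sum_distrib_left scaleR_scaleR scaleR_sum_right)
    ultimately show ?thesis by presburger
  qed
  have g0: "u (?g 0) = 1" using u0nz by (simp add: u_def)
  have alt: "u (?g k) * u (?g (Suc k)) < 0" if k: "Suc k < 2 * m" for k
  proof -
    let ?R = "?T - {real k, real (Suc k)}"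
    have "0 < (\<Prod>s\<in>?R. (real k - s) * (real (Suc k) - s))"
    proof (rule prod_pos)
      fix s assume "s \<in> ?R"
      then obtain j where "s = real j" "j \<noteq> k" "j \<noteq> Suc k" by auto
      then consider "s \<le> real k - 1" | "s \<ge> real (Suc k) + 1"
        by (cases "j < k") auto
      then show "0 < (real k - s) * (real (Suc k) - s)"
        by cases (auto intro: mult_pos_pos mult_neg_neg)
    qed
    then have pos: "0 < (\<Prod>s\<in>?R. real k - s) * (\<Prod>s\<in>?R. real (Suc k) - s)"
      by (simp only: prod.distrib)
    define x where "x = (\<Prod>s\<in>?R. real k - s)"
    define y where "y = (\<Prod>s\<in>?R. real (Suc k) - s)"
    have eq: "u (?g k) * x + u (?g (Suc k)) * y = 0"
      using pair[OF u, of k "Suc k"] k by (simp add: x_def y_def)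
    then have uy: "u (?g (Suc k)) * y = - (u (?g k) * x)" by linarith
    have xy: "0 < x * y" using pos by (simp add: x_def y_def)
    have uk: "u (?g k) \<noteq> 0" using zero[OF u, of k 0] k g0 by auto
    have "u (?g k) * u (?g (Suc k)) * (x * y) = (u (?g k) * x) * (u (?g (Suc k)) * y)" by simp
    also have "\<dots> = - (u (?g k) * x)\<^sup>2" unfolding uy by (simp add: power2_eq_square)
    finally have "u (?g k) * u (?g (Suc k)) * (x * y) < 0" using uk xy by auto
    then show ?thesis
      using mult_less_cancel_right_pos[OF xy, of "u (?g k) * u (?g (Suc k))" 0] by (simp only: mult_zero_left)
  qed
  have sign: "if even k then u (?g k) > 0 else u (?g k) < 0" if "k < 2 * m" for k
    using that
  proof (induction k)
    case (Suc k)
    then show ?case using alt[OF Suc.prems] by (auto simp: mult_less_0_iff split: if_splits)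
  qed (use g0 in simp)
  define B where "B = ?g ` {k. k < 2 * m \<and> even k}"
  define C where "C = ?g ` {k. k < 2 * m \<and> odd k}"
  have BC: "B \<union> C = ?S" unfolding B_def C_def S by auto
  have "{k. k < 2 * m \<and> even k} = (\<lambda>k. 2 * k) ` {..<m}" by (auto elim!: evenE)
  then have "card {k. k < 2 * m \<and> even k} = m" by (simp add: card_image inj_on_def)
  then have cB: "card B = m" unfolding B_def using card_image[OF inj_on_subset[OF inj]] by simp
  have "{k. k < 2 * m \<and> odd k} = (\<lambda>k. 2 * k + 1) ` {..<m}" by (auto elim!: oddE)
  then have "card {k. k < 2 * m \<and> odd k} = m" by (simp add: card_image inj_on_def)
  then have cC: "card C = m" unfolding C_def using card_image[OF inj_on_subset[OF inj]] by simp
  have uB: "\<forall>x\<in>B. 0 < u x"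
  proof
    fix x assume "x \<in> B"
    then obtain k where "x = ?g k" "k < 2 * m" "even k" unfolding B_def by blast
    then show "0 < u x" using sign[of k] by simp
  qed
  have uC: "\<forall>x\<in>C. u x < 0"
  proof
    fix x assume "x \<in> C"
    then obtain k where "x = ?g k" "k < 2 * m" "odd k" unfolding C_def by blast
    then show "u x < 0" using sign[of k] by simp
  qed
  have "B \<inter> C = {}" unfolding B_def C_def using inj by (auto dest: injD)
  moreover have "finite B" "finite C" by (auto simp: B_def C_def)
  moreover have all: "\<exists>k. \<forall>x\<in>?S. r x = k * u x" if r: "affine_rel ?S r" for r
  proof -
    let ?q = "\<lambda>x. r x - r (?g 0) * u x"
    have "affine_rel ?S ?q"
      using r u by (simp add: affine_rel_def sum_subtractf scaleR_left_diff_distrib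
          flip: sum_distrib_left scaleR_scaleR scaleR_sum_right)
    moreover have "?q (?g 0) = 0" using g0 by simp
    ultimately have "?q (?g j) = 0" if "j < 2 * m" for j using zero[of ?q 0 j] that by simp
    then show ?thesis unfolding S by (intro exI[of _ "r (?g 0)"]) auto
  qed
  ultimately have "radon_config {} B C"
    unfolding radon_config_def Un_empty_left BC using d(2) cB cC u uB uC
    by (intro conjI exI[of _ u] allI impI) (blast | simp)+
  then show ?thesis using that cB cC BC by blast
qed

end

lemma radon_config_add_Basis:
  assumes R: "radon_config {} B C" and A: "finite A" "A \<subseteq> Basis"
    and orth: "\<And>x a. x \<in> B \<union> C \<Longrightarrow> a \<in> A \<Longrightarrow> a \<bullet> x = 0"
  shows "radon_config A B C"
proof -
  have fin: "finite (A \<union> B \<union> C)" and sub: "B \<union> C \<subseteq> A \<union> B \<union> C" using R A by (auto simp: radon_config_def)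
  have disj: "A \<inter> (B \<union> C) = {}"
  proof (rule ccontr)
    assume "A \<inter> (B \<union> C) \<noteq> {}"
    then obtain a where "a \<in> A" "a \<in> B \<union> C" by blast
    then have "a \<bullet> a = 0" "a \<in> Basis" using orth A by blast+
    then show False by simp
  qed
  obtain u where u: "affine_rel (B \<union> C) u" "\<forall>x\<in>B. 0 < u x" "\<forall>x\<in>C. u x < 0"
    and all: "\<And>r. affine_rel (B \<union> C) r \<Longrightarrow> \<exists>k. \<forall>x\<in>B \<union> C. r x = k * u x"
    using R by (auto simp: radon_config_def)
  define u' where "u' x = (if x \<in> B \<union> C then u x else 0)" for x
  have "affine_rel (B \<union> C) u'" using u(1) by (simp add: affine_rel_def u'_def)
  then have u': "affine_rel (A \<union> B \<union> C) u'"
    using affine_rel_mono[OF fin sub, of u'] by (simp add: u'_def)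
  have "\<exists>k. \<forall>x\<in>A \<union> B \<union> C. r x = k * u' x" if r: "affine_rel (A \<union> B \<union> C) r" for r
  proof -
    have rA: "r a = 0" if a: "a \<in> A" for a
    proof -
      have "0 = (\<Sum>x\<in>A \<union> B \<union> C. r x * (a \<bullet> x))" using affine_rel_inner[OF r, of a 0] by simp
      also have "\<dots> = (\<Sum>x\<in>A \<union> B \<union> C. if x = a then r a else 0)"
      proof (rule sum.cong)
        fix x assume "x \<in> A \<union> B \<union> C"
        moreover have "a \<bullet> a = 1" using a A by auto
        moreover have "a \<bullet> x = 0" if "x \<noteq> a" "x \<in> A" using that a A inner_not_same_Basis[of a x] by auto
        ultimately show "r x * (a \<bullet> x) = (if x = a then r a else 0)" using orth a by auto
      qed simp
      also have "\<dots> = r a" using fin a by simp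
      finally show ?thesis by simp
    qed
    then have "affine_rel (B \<union> C) r" using affine_rel_mono[OF fin sub, of r] r by auto
    then obtain k where "\<forall>x\<in>B \<union> C. r x = k * u x" using all by blast
    then have "\<forall>x\<in>A \<union> B \<union> C. r x = k * u' x" using rA disj by (auto simp: u'_def)
    then show ?thesis ..
  qed
  moreover have "\<forall>x\<in>A. u' x = 0" "\<forall>x\<in>B. 0 < u' x" "\<forall>x\<in>C. u' x < 0"
    using disj u by (auto simp: u'_def)
  ultimately show ?thesis using R A(1) disj u' unfolding radon_config_def by auto
qed

lemma pyramid_over_cyclic_polytope:
  assumes m: "2 \<le> m" and dim: "3 * m - 3 \<le> DIM('a::euclidean_space)"
  obtains K A B C where "radon_config A B (C :: 'a set)" "card A = m - 1" "card B = m" "card C = m"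
    "cyclic_polytope (2 * m) (2 * m - 2) K"
    "fold_pyramid (m - 1) (3 * int m - 3) K (convex hull (A \<union> B \<union> C))"
proof -
  define d where "d = 2 * m - 2"
  have d: "d + 2 = 2 * m" using m by (simp add: d_def)
  obtain E :: "nat \<Rightarrow> 'a" where E: "bij_betw E {0..<DIM('a)} Basis"
    using ex_bij_betw_nat_finite[OF finite_Basis] by blast
  have injE: "inj_on E {0..<DIM('a)}" using E by (rule bij_betw_imp_inj_on)
  have Ein: "E i \<in> Basis" if "i < DIM('a)" for i using E that by (auto simp: bij_betw_def)
  have le: "d + (m - 1) \<le> DIM('a)" using dim m by (simp add: d_def)
  have e: "inj_on E {..<d}" "E ` {..<d} \<subseteq> Basis"
    using injE Ein le by (auto intro: inj_on_subset)
  obtain B C where BC: "radon_config {} B C" "card B = m" "card C = m"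
    "B \<union> C = moment E d ` real ` {..<2 * m}"
    using moment_radon_config[OF e d m] .
  define A where "A = E ` {d..<d + (m - 1)}"
  have A: "finite A" "A \<subseteq> Basis" using Ein le by (auto simp: A_def)
  have "card A = m - 1"
    unfolding A_def using le by (subst card_image) (auto intro: inj_on_subset[OF injE])
  have orth: "a \<bullet> x = 0" if x: "x \<in> B \<union> C" and a: "a \<in> A" for x a
  proof -
    obtain t where t: "x = moment E d t" using x BC(4) by auto
    obtain j where j: "a = E j" "d \<le> j" "j < d + (m - 1)" using a by (auto simp: A_def)
    have "E j \<bullet> E i = 0" if "i < d" for i
    proof (rule inner_not_same_Basis)
      show "E j \<noteq> E i" using inj_onD[OF injE, of j i] that j le by auto
    qed (use that j le Ein in auto)
    then show ?thesis by (simp add: t j(1) moment_def inner_sum_right)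
  qed
  have R: "radon_config A B C" by (rule radon_config_add_Basis[OF BC(1) A orth])
  have dimBC: "aff_dim (B \<union> C) = 2 * int m - 2" using radon_aff_dim[OF BC(1)] BC(2,3) by simp
  have finBC: "finite (B \<union> C)" unfolding BC(4) by simp
  have "fold_pyramid (card A) (aff_dim (B \<union> C) + int (card A)) (convex hull (B \<union> C)) (convex hull (A \<union> (B \<union> C)))"
    using fold_pyramid_Basis[OF A finBC orth] by blast
  moreover have "aff_dim (B \<union> C) + int (card A) = 3 * int m - 3"
    using dimBC \<open>card A = m - 1\<close> m by simp
  ultimately have F: "fold_pyramid (m - 1) (3 * int m - 3) (convex hull (B \<union> C)) (convex hull (A \<union> B \<union> C))"
    using \<open>card A = m - 1\<close> by (simp add: Un_assoc)
  have "cyclic_polytope (2 * m) (2 * m - 2) (convex hull (B \<union> C))"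
    unfolding cyclic_polytope_def
  proof (intro exI conjI)
    show "inj_on E {..<2 * m - 2}" "E ` {..<2 * m - 2} \<subseteq> Basis" using e by (simp_all add: d_def)
    show "card (real ` {..<2 * m}) = 2 * m" by (simp add: card_image inj_on_of_nat)
    show "convex hull (B \<union> C) = convex hull (\<lambda>t. \<Sum>i<2 * m - 2. t ^ (i + 1) *\<^sub>R E i) ` real ` {..<2 * m}"
      unfolding BC(4) moment_def[abs_def] d_def ..
  qed simp
  then show ?thesis using that R \<open>card A = m - 1\<close> BC(2,3) F by blast
qed

section \<open>Three classes of points with equal sums\<close>

text \<open>
  The assumption on relations combines two facts: the sums over the classes agree, and
  this generates all affine relations. Stating it through class values \<open>\<alpha>\<close> treats the three classes
  symmetrically.
\<close>

locale equal_sum_classes =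
  fixes V :: "nat \<Rightarrow> 'b::euclidean_space set" and m :: nat
  assumes fin: "i \<in> {1, 2, 3} \<Longrightarrow> finite (V i)"
    and card: "i \<in> {1, 2, 3} \<Longrightarrow> card (V i) = m"
    and disj: "i \<in> {1, 2, 3} \<Longrightarrow> j \<in> {1, 2, 3} \<Longrightarrow> i \<noteq> j \<Longrightarrow> V i \<inter> V j = {}"
    and m: "2 \<le> m"
    and rel_iff: "affine_rel (V 1 \<union> V 2 \<union> V 3) r \<longleftrightarrow>
      (\<exists>\<alpha>. \<alpha> 1 + \<alpha> 2 + \<alpha> 3 = 0 \<and> (\<forall>i\<in>{1, 2, 3}. \<forall>x\<in>V i. r x = \<alpha> i))"
begin

definition "S = V 1 \<union> V 2 \<union> V 3"

lemma fins: "finite (V 1)" "finite (V 2)" "finite (V 3)" and finS: "finite S"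
  using fin by (auto simp: S_def)

lemma cards: "card (V 1) = m" "card (V 2) = m" "card (V 3) = m"
  using card by auto

lemma disjs: "V 1 \<inter> V 2 = {}" "V 1 \<inter> V 3 = {}" "V 2 \<inter> V 3 = {}"
  using disj by auto

lemma rel_S: "affine_rel S r \<longleftrightarrow>
  (\<exists>\<alpha>. \<alpha> 1 + \<alpha> 2 + \<alpha> 3 = 0 \<and> (\<forall>i\<in>{1, 2, 3}. \<forall>x\<in>V i. r x = \<alpha> i))"
  unfolding S_def by (rule rel_iff)

lemma rel_S':
  assumes "\<And>x. x \<in> V 1 \<Longrightarrow> r x = a" "\<And>x. x \<in> V 2 \<Longrightarrow> r x = b" "\<And>x. x \<in> V 3 \<Longrightarrow> r x = c" "a + b + c = 0"
  shows "affine_rel S r"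
  unfolding rel_S
  by (rule exI[of _ "\<lambda>i. if i = 1 then a else if i = 2 then b else c"]) (use assms in auto)

lemma rel_S_E:
  assumes "affine_rel S r"
  obtains \<alpha> where "\<alpha> 1 + \<alpha> 2 + \<alpha> 3 = 0" "\<And>i x. i \<in> {1, 2, 3} \<Longrightarrow> x \<in> V i \<Longrightarrow> r x = \<alpha> i"
  using assms unfolding rel_S by blast

lemma S_cases:
  assumes "x \<in> S" obtains i where "i \<in> {1, 2, 3}" "x \<in> V i"
  using assms unfolding S_def by blast

lemma V_sub: "i \<in> {1, 2, 3} \<Longrightarrow> V i \<subseteq> S"
  unfolding S_def by auto

lemma independent:
  assumes J: "J \<subseteq> S" "\<forall>i\<in>{1, 2, 3}. \<not> V i \<subseteq> J"
  shows "\<not> affine_dependent J"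
  unfolding affine_independent_iff_rel[OF finS J(1)]
proof (intro allI impI ballI, elim conjE)
  fix r x assume r: "affine_rel S r" "\<forall>x\<in>S - J. r x = 0" and x: "x \<in> J"
  obtain \<alpha> where \<alpha>: "\<And>i x. i \<in> {1, 2, 3} \<Longrightarrow> x \<in> V i \<Longrightarrow> r x = \<alpha> i" using rel_S_E[OF r(1)] by metis
  obtain i where i: "i \<in> {1, 2, 3}" "x \<in> V i" using J x S_cases by blast
  then obtain y where y: "y \<in> V i" "y \<notin> J" using J(2) by blast
  have "y \<in> S" using V_sub[OF i(1)] y by blast
  then show "r x = 0" using \<alpha>[OF i] \<alpha>[OF i(1) y(1)] r(2) y(2) by auto
qed

text \<open>
  If \<open>J\<close> contains the class \<open>V i\<close> but not everything, the relation with value \<open>-2\<close> on \<open>V i\<close> and \<open>1\<close> on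
  the other classes violates Gale's criterion. If \<open>J\<close> misses a point of each class, a relation that is
  nonnegative there has three nonnegative values with sum zero.
\<close>

lemma face_set_S:
  assumes J: "J \<subseteq> S"
  shows "face_set S J \<longleftrightarrow> J = S \<or> (\<forall>i\<in>{1, 2, 3}. \<not> V i \<subseteq> J)"
proof
  assume face: "face_set S J"
  show "J = S \<or> (\<forall>i\<in>{1, 2, 3}. \<not> V i \<subseteq> J)"
  proof (rule ccontr)
    assume "\<not> (J = S \<or> (\<forall>i\<in>{1, 2, 3}. \<not> V i \<subseteq> J))"
    then obtain i where i: "i \<in> {1, 2, 3}" "V i \<subseteq> J" and "J \<noteq> S" by blast
    then obtain x where x: "x \<in> S - J" using J by blast
    define r where "r x = (if x \<in> V i then -2 else 1 :: real)" for x
    have "affine_rel S r"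
      unfolding rel_S
    proof (intro exI[of _ "\<lambda>j. if j = i then -2 else 1 :: real"] conjI ballI)
      fix j y assume j: "j \<in> {1, 2, 3}" "y \<in> V j"
      then show "r y = (if j = i then -2 else 1)" using disj[OF j(1) i(1)] by (auto simp: r_def)
    qed (use i(1) in auto)
    moreover have "\<forall>x\<in>S - J. r x = 1" using i(2) by (auto simp: r_def)
    ultimately show False using face x unfolding face_set_iff[OF finS J] by force
  qed
next
  assume "J = S \<or> (\<forall>i\<in>{1, 2, 3}. \<not> V i \<subseteq> J)"
  then show "face_set S J"
  proof
    assume nV: "\<forall>i\<in>{1, 2, 3}. \<not> V i \<subseteq> J"
    show ?thesis
      unfolding face_set_iff[OF finS J]
    proof (intro allI impI, elim conjE)
      fix r assume r: "affine_rel S r" "\<forall>x\<in>S - J. 0 \<le> r x"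
      obtain \<alpha> where \<alpha>: "\<alpha> 1 + \<alpha> 2 + \<alpha> 3 = 0" "\<And>i x. i \<in> {1, 2, 3} \<Longrightarrow> x \<in> V i \<Longrightarrow> r x = \<alpha> i"
        using rel_S_E[OF r(1)] by blast
      have "0 \<le> \<alpha> i" if i: "i \<in> {1, 2, 3}" for i
      proof -
        obtain y where y: "y \<in> V i" "y \<notin> J" using nV i by blast
        then have "y \<in> S - J" using V_sub[OF i] by blast
        then have "0 \<le> r y" using r(2) by blast
        then show ?thesis using \<alpha>(2)[OF i y(1)] by simp
      qed
      from this[of 1] this[of 2] this[of 3] have "\<alpha> 1 = 0" "\<alpha> 2 = 0" "\<alpha> 3 = 0" using \<alpha>(1) by auto
      then have "\<alpha> i = 0" if "i \<in> {1, 2, 3}" for i using that by auto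
      then show "\<forall>x\<in>S - J. r x = 0" using \<alpha>(2) S_cases by (metis DiffD1)
    qed
  qed (simp add: face_set_whole)
qed

lemma not_V_sub:
  assumes "finite J" "card J < m" "i \<in> {1, 2, 3}"
  shows "\<not> V i \<subseteq> J"
  using card_mono[OF assms(1), of "V i"] card[OF assms(3)] assms(2) by auto

lemma singleton_face_set: "x \<in> S \<Longrightarrow> face_set S {x}"
  using face_set_S[of "{x}"] not_V_sub[of "{x}"] m by auto

lemma vertices_face_set_S: "face_set S J \<Longrightarrow> vertices (convex hull J) = J"
  by (rule vertices_face_set[OF singleton_face_set])

theorem vertices_hull: "vertices (convex hull S) = S"
  by (rule vertices_face_set_S[OF face_set_whole])

theorem proper_face_iff:
  assumes J: "J \<subset> S"
  shows "(convex hull J) proper_face_of (convex hull S) \<longleftrightarrow> (\<forall>i\<in>{1, 2, 3}. \<not> V i \<subseteq> J)"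
proof
  assume pf: "(convex hull J) proper_face_of (convex hull S)"
  show "\<forall>i\<in>{1, 2, 3}. \<not> V i \<subseteq> J"
  proof (intro ballI notI)
    fix i assume i: "i \<in> {1, 2, 3}" "V i \<subseteq> J"
    have "face_set S (convex hull J \<inter> S)"
      using face_set_Int[OF finS] pf by (simp add: proper_face_of_def)
    moreover have "V i \<subseteq> convex hull J \<inter> S" using i V_sub hull_subset[of J convex] by blast
    ultimately have "convex hull J \<inter> S = S" using face_set_S[of "convex hull J \<inter> S"] i(1) by blast
    then have "convex hull S \<subseteq> convex hull J" by (intro hull_minimal) auto
    moreover have "convex hull J \<subseteq> convex hull S" using J by (intro hull_mono) auto
    ultimately show False using pf by (simp add: proper_face_of_def)
  qed
next
  assume "\<forall>i\<in>{1, 2, 3}. \<not> V i \<subseteq> J"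
  then have face: "face_set S J" using face_set_S J by blast
  have "convex hull J \<noteq> convex hull S"
  proof
    assume "convex hull J = convex hull S"
    then have "S \<subseteq> J" using face_set_subset_iff[OF face_set_whole face] by simp
    then show False using J by blast
  qed
  then show "(convex hull J) proper_face_of (convex hull S)"
    using face by (simp add: proper_face_of_def face_set_def)
qed

theorem simplicial: "simplicial_polytope (convex hull S)"
  unfolding simplicial_polytope_def
proof (intro conjI allI impI)
  show "polytope (convex hull S)" by (rule polytope_convex_hull[OF finS])
next
  fix F assume F: "F proper_face_of convex hull S"
  then have face: "F face_of convex hull S" by (simp add: proper_face_of_def)
  have J: "face_set S (F \<inter> S)" and hull: "convex hull (F \<inter> S) = F"
    using face_set_Int[OF finS face] face_Int_hull[OF finS face] by auto
  have "F \<inter> S \<noteq> S" using F hull by (auto simp: proper_face_of_def)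
  then have "\<not> affine_dependent (F \<inter> S)" using J face_set_S[of "F \<inter> S"] independent[of "F \<inter> S"] by blast
  then show "is_simplex F" using is_simplex_hull_iff[OF vertices_face_set_S[OF J]] hull by simp
qed

theorem neighborly: "neighborly (m - 1) (convex hull S)"
  unfolding neighborly_def vertices_hull
proof (intro conjI allI impI, goal_cases)
  case 1
  show ?case by (rule polytope_convex_hull[OF finS])
next
  case (2 T)
  then have T: "T \<subseteq> S" "card T < m" using m by auto
  then have nV: "\<forall>i\<in>{1, 2, 3}. \<not> V i \<subseteq> T" using not_V_sub finite_subset[OF T(1) finS] by blast
  then have face: "face_set S T" using face_set_S[OF T(1)] by blast
  have "T \<subset> S" using T(1) nV V_sub[of 1] by blast
  then have "(convex hull T) proper_face_of (convex hull S)" using proper_face_iff nV by blast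
  then show ?case using vertices_face_set_S[OF face] by blast
qed

lemma radon:
  assumes w: "w \<in> V 1"
  shows "radon_config (V 1 - {w}) (V 2) (V 3)" and "V 1 - {w} \<union> V 2 \<union> V 3 = S - {w}"
proof -
  show S': "V 1 - {w} \<union> V 2 \<union> V 3 = S - {w}" using w disjs by (auto simp: S_def)
  define u where "u x = (if x \<in> V 2 then 1 else if x \<in> V 3 then -1 else 0 :: real)" for x
  have "affine_rel S u"
    by (rule rel_S'[of _ 0 1 "-1"]) (use disjs in \<open>auto simp: u_def\<close>)
  moreover have "u w = 0" using w disjs by (auto simp: u_def)
  ultimately have u: "affine_rel (S - {w}) u"
    using affine_rel_mono[OF finS, of "S - {w}" u] by blast
  have "\<exists>k. \<forall>x\<in>S - {w}. r x = k * u x" if r: "affine_rel (S - {w}) r" for r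
  proof -
    define r' where "r' x = (if x = w then 0 else r x)" for x
    have "affine_rel (S - {w}) r'" using r by (simp add: affine_rel_def r'_def)
    then have "affine_rel S r'" using affine_rel_mono[OF finS, of "S - {w}" r'] by (auto simp: r'_def)
    then obtain \<alpha> where \<alpha>: "\<alpha> 1 + \<alpha> 2 + \<alpha> 3 = 0" "\<And>i x. i \<in> {1, 2, 3} \<Longrightarrow> x \<in> V i \<Longrightarrow> r' x = \<alpha> i"
      using rel_S_E by blast
    have a1: "\<alpha> 1 = 0" using \<alpha>(2)[of 1 w] w by (simp add: r'_def)
    have "r x = \<alpha> 2 * u x" if x: "x \<in> S - {w}" for x
    proof -
      have "r x = r' x" using x by (simp add: r'_def)
      moreover consider "x \<in> V 1" | "x \<in> V 2" | "x \<in> V 3" using x by (auto simp: S_def)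
      then have "r' x = \<alpha> 2 * u x"
      proof cases
        case 1
        then show ?thesis using \<alpha>(2)[of 1 x] a1 disjs by (auto simp: u_def)
      next
        case 2
        then show ?thesis using \<alpha>(2)[of 2 x] by (simp add: u_def)
      next
        case 3
        moreover have "x \<notin> V 2" using 3 disjs by blast
        ultimately show ?thesis using \<alpha>(2)[of 3 x] \<alpha>(1) a1 by (simp add: u_def)
      qed
      ultimately show ?thesis by simp
    qed
    then show ?thesis by blast
  qed
  moreover have "\<forall>x\<in>V 1 - {w}. u x = 0" "\<forall>x\<in>V 2. 0 < u x" "\<forall>x\<in>V 3. u x < 0"
    using disjs by (auto simp: u_def)
  ultimately show "radon_config (V 1 - {w}) (V 2) (V 3)"
    unfolding radon_config_def S' using fins cards m disjs u
    by (intro conjI exI[of _ u] allI impI) (blast | simp)+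
qed

lemma aff_dim_S: "aff_dim S = 3 * int m - 3"
  and aff_dim_S_remove: "w \<in> V 1 \<Longrightarrow> aff_dim (S - {w}) = 3 * int m - 3"
proof -
  have eq: "aff_dim (S - {w}) = 3 * int m - 3" "aff_dim (S - {w}) = aff_dim S" if w: "w \<in> V 1" for w
  proof -
    have "card (V 1 - {w}) = m - 1" using w cards fins by simp
    then show "aff_dim (S - {w}) = 3 * int m - 3"
      using radon_aff_dim[OF radon(1)[OF w]] unfolding radon(2)[OF w] using cards m by simp
    define r where "r x = (if x \<in> V 1 then 1 else if x \<in> V 2 then -1 else 0 :: real)" for x
    have "affine_rel S r"
      by (rule rel_S'[of _ 1 "-1" 0]) (use disjs in \<open>auto simp: r_def\<close>)
    then show "aff_dim (S - {w}) = aff_dim S"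
      using w V_sub[of 1] by (intro aff_dim_remove_rel[OF finS, of r]) (auto simp: r_def)
  qed
  obtain w where "w \<in> V 1" using cards m by (metis card.empty ex_in_conv not_numeral_le_zero)
  then show "aff_dim S = 3 * int m - 3" using eq[of w] by simp
  show "w \<in> V 1 \<Longrightarrow> aff_dim (S - {w}) = 3 * int m - 3" for w by (rule eq(1))
qed

text \<open>
  The value at \<open>w\<close> of an affine function, from \<open>w = \<Sum>V 2 - \<Sum>(V 1 - {w})\<close>. This is an affine
  combination because the numbers of terms differ by one.
\<close>

lemma sum_apexes:
  assumes w: "w \<in> V 1"
  shows "a \<bullet> w - b = (\<Sum>x\<in>V 2. a \<bullet> x - b) - (\<Sum>x\<in>V 1 - {w}. a \<bullet> x - b)"
proof -
  define r where "r x = (if x \<in> V 1 then 1 else if x \<in> V 2 then -1 else 0 :: real)" for x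
  have r: "affine_rel S r"
    by (rule rel_S'[of _ 1 "-1" 0]) (use disjs in \<open>auto simp: r_def\<close>)
  have "0 = (\<Sum>x\<in>S. r x * (a \<bullet> x - b))" using affine_rel_inner[OF r] by simp
  also have "\<dots> = (\<Sum>x\<in>V 1. r x * (a \<bullet> x - b)) + (\<Sum>x\<in>V 2. r x * (a \<bullet> x - b)) + (\<Sum>x\<in>V 3. r x * (a \<bullet> x - b))"
    unfolding S_def using fins disjs by (subst sum.union_disjoint; auto)+
  also have "(\<Sum>x\<in>V 1. r x * (a \<bullet> x - b)) = (\<Sum>x\<in>V 1. a \<bullet> x - b)"
    by (intro sum.cong) (auto simp: r_def)
  also have "\<dots> = (a \<bullet> w - b) + (\<Sum>x\<in>V 1 - {w}. a \<bullet> x - b)"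
    using w fins by (intro sum.remove)
  also have "(\<Sum>x\<in>V 2. r x * (a \<bullet> x - b)) = (\<Sum>x\<in>V 2. - (a \<bullet> x - b))"
    using disjs by (intro sum.cong) (auto simp: r_def)
  also have "\<dots> = - (\<Sum>x\<in>V 2. a \<bullet> x - b)" by (rule sum_negf)
  also have "(\<Sum>x\<in>V 3. r x * (a \<bullet> x - b)) = 0"
    using disjs by (intro sum.neutral) (auto simp: r_def)
  finally show ?thesis by linarith
qed

text \<open>
  The affine function that defines a facet is nonpositive on \<open>Q\<close>. On a simplex facet it vanishes on
  \<open>V 1 - {w}\<close>, so its value at \<open>w\<close> is a sum of values on \<open>V 2\<close> and not positive. On a facet that
  omits only \<open>v \<in> V 1\<close>, all terms but the one for \<open>v\<close> vanish, and that one enters with a minus sign.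
\<close>

lemma beyond_iff:
  assumes w: "w \<in> V 1" and F: "F facet_of convex hull (S - {w})"
  shows "beyond w (convex hull (S - {w})) F \<longleftrightarrow> \<not> is_simplex F"
proof
  let ?Q = "convex hull (S - {w})"
  note R = radon(1)[OF w] and S' = radon(2)[OF w]
  have inQ: "x \<in> ?Q" if "x \<in> V 2 \<or> x \<in> V 1 - {w}" for x
    using that disjs w by (intro hull_inc) (auto simp: S_def)
  {
    assume "beyond w ?Q F"
    then obtain a b where ab: "affine hull F = affine hull ?Q \<inter> {x. a \<bullet> x = b}"
      "\<forall>x\<in>rel_interior ?Q. a \<bullet> x < b" "a \<bullet> w > b"
      unfolding beyond_def by blast
    show "\<not> is_simplex F"
    proof
      assume "is_simplex F"
      then have "V 1 - {w} \<subseteq> F" using radon_facet_simplex_imp[OF R, unfolded S'] F by blast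
      then have A: "a \<bullet> x - b = 0" if "x \<in> V 1 - {w}" for x
        using ab(1) that hull_subset[of F affine] by auto
      have "closure (rel_interior ?Q) \<subseteq> {x. a \<bullet> x \<le> b}"
        using ab(2) by (intro closure_minimal) (auto simp: closed_halfspace_le less_imp_le)
      then have "?Q \<subseteq> {x. a \<bullet> x \<le> b}"
        using convex_closure_rel_interior[of ?Q] closure_subset[of ?Q] by auto
      then have "a \<bullet> x - b \<le> 0" if "x \<in> V 2" for x using inQ[of x] that by auto
      then have "(\<Sum>x\<in>V 2. a \<bullet> x - b) \<le> 0" by (rule sum_nonpos)
      then have "a \<bullet> w - b \<le> 0" unfolding sum_apexes[OF w] using A by simp
      then show False using ab(3) by simp
    qed
  next
    assume "\<not> is_simplex F"
    then have "F \<in> (\<lambda>a. convex hull (S - {w} - {a})) ` (V 1 - {w})"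
      using radon_nonsimplex_facets(1)[OF R, unfolded S'] F by blast
    then obtain v where v: "v \<in> V 1 - {w}" "F = convex hull (S - {w} - {v})" by blast
    have poly: "polytope ?Q" using finS by (intro polytope_convex_hull) auto
    obtain a b where ab: "?Q \<subseteq> {x. a \<bullet> x \<le> b}" "F = ?Q \<inter> {x. a \<bullet> x = b}"
      "affine hull F = affine hull ?Q \<inter> {x. a \<bullet> x = b}" "\<And>x. x \<in> rel_interior ?Q \<Longrightarrow> a \<bullet> x < b"
      using facet_hyperplane[OF poly F] by blast
    have F0: "a \<bullet> x - b = 0" if "x \<in> S - {w} - {v}" for x
      using that hull_inc[of x "S - {w} - {v}" convex] ab(2) v(2) by auto
    have "aff_dim F < aff_dim ?Q" using F by (simp add: facet_of_def)
    have "v \<notin> F"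
    proof
      assume "v \<in> F"
      then have "S - {w} \<subseteq> F" using v hull_subset[of "S - {w} - {v}" convex] by blast
      then have "?Q \<subseteq> F" using v(2) by (intro hull_minimal) auto
      then have "aff_dim ?Q \<le> aff_dim F" by (rule aff_dim_subset)
      then show False using \<open>aff_dim F < aff_dim ?Q\<close> by simp
    qed
    then have v0: "a \<bullet> v - b < 0" using ab(1,2) inQ[of v] v(1) by force
    have "(\<Sum>x\<in>V 2. a \<bullet> x - b) = 0"
      using v w disjs by (intro sum.neutral ballI F0) (auto simp: S_def)
    moreover have "(\<Sum>x\<in>V 1 - {w}. a \<bullet> x - b) = (a \<bullet> v - b) + (\<Sum>x\<in>V 1 - {w} - {v}. a \<bullet> x - b)"
      using v fins by (intro sum.remove) auto
    moreover have "(\<Sum>x\<in>V 1 - {w} - {v}. a \<bullet> x - b) = 0"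
      by (intro sum.neutral ballI F0) (auto simp: S_def)
    ultimately have "a \<bullet> w > b" using sum_apexes[OF w, of a b] v0 by simp
    moreover have "w \<in> affine hull ?Q"
    proof -
      define r where "r x = (if x \<in> V 1 then 1 else if x \<in> V 2 then -1 else 0 :: real)" for x
      have "affine_rel S r"
        by (rule rel_S'[of _ 1 "-1" 0]) (use disjs in \<open>auto simp: r_def\<close>)
      then have "w \<in> affine hull (S - {w})"
        using w by (intro affine_rel_imp_mem_affine_hull[OF finS]) (auto simp: r_def S_def)
      then show ?thesis by simp
    qed
    ultimately show "beyond w ?Q F" unfolding beyond_def using F ab(3,4) by blast
  }
qed

theorem beyond_facets:
  assumes w: "w \<in> V 1"
  shows "{F. F facet_of convex hull (S - {w}) \<and> beyond w (convex hull (S - {w})) F}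
      = {F. F facet_of convex hull (S - {w}) \<and> \<not> is_simplex F}"
    and "card {F. F facet_of convex hull (S - {w}) \<and> \<not> is_simplex F} = m - 1"
proof -
  show "{F. F facet_of convex hull (S - {w}) \<and> beyond w (convex hull (S - {w})) F}
      = {F. F facet_of convex hull (S - {w}) \<and> \<not> is_simplex F}"
    using beyond_iff[OF w] by blast
  show "card {F. F facet_of convex hull (S - {w}) \<and> \<not> is_simplex F} = m - 1"
    using radon_nonsimplex_facets(2)[OF radon(1)[OF w]] unfolding radon(2)[OF w]
    using w cards fins by simp
qed

theorem pyramid_over_cyclic:
  assumes w: "w \<in> V 1" and dim: "3 * m - 3 \<le> DIM('c::euclidean_space)"
  obtains K R :: "'c::euclidean_space set" where "cyclic_polytope (2 * m) (2 * m - 2) K"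
    "fold_pyramid (m - 1) (3 * int m - 3) K R" "comb_equiv (convex hull (S - {w})) R"
proof -
  obtain K A B C :: "'c set" where R: "radon_config A B C" "card A = m - 1" "card B = m" "card C = m"
    and K: "cyclic_polytope (2 * m) (2 * m - 2) K"
      "fold_pyramid (m - 1) (3 * int m - 3) K (convex hull (A \<union> B \<union> C))"
    by (rule pyramid_over_cyclic_polytope[OF m dim])
  have "comb_equiv (convex hull (S - {w})) (convex hull (A \<union> B \<union> C))"
    unfolding radon(2)[OF w, symmetric]
    using w cards fins R by (intro radon_comb_equiv[OF radon(1)[OF w] R(1)]) auto
  then show ?thesis using that K by blast
qed

end

section \<open>The Gale diagram\<close>

lemma affine_relation_nth:
  assumes "distinct vs" "\<And>j. j < length vs \<Longrightarrow> a j = r (vs ! j)"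
  shows "affine_relation vs a \<longleftrightarrow> affine_rel (set vs) r"
proof -
  have bij: "bij_betw ((!) vs) {..<length vs} (set vs)" using assms(1) by (intro bij_betw_nth) auto
  have "(\<Sum>j<length vs. a j) = (\<Sum>j<length vs. r (vs ! j))"
    "(\<Sum>j<length vs. a j *\<^sub>R vs ! j) = (\<Sum>j<length vs. r (vs ! j) *\<^sub>R vs ! j)"
    using assms(2) by (auto intro!: sum.cong)
  then show ?thesis
    using sum.reindex_bij_betw[OF bij, of r] sum.reindex_bij_betw[OF bij, of "\<lambda>x. r x *\<^sub>R x"]
    by (simp add: affine_relation_def affine_rel_def)
qed

lemma ex_function_on_list:
  assumes "distinct vs"
  obtains r where "\<And>j. j < length vs \<Longrightarrow> a j = r (vs ! j)"
proof
  fix j assume j: "j < length vs"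
  have "inj_on ((!) vs) {..<length vs}" using assms by (intro inj_on_nth) auto
  then show "a j = (a \<circ> inv_into {..<length vs} ((!) vs)) (vs ! j)"
    using j by (simp add: inv_into_f_f)
qed

context equal_sum_classes
begin

text \<open>
  The rows of the matrix whose columns are the relations \<open>\<Sum>V 1 - \<Sum>V 2\<close> and \<open>\<Sum>V 1 - \<Sum>V 3\<close>.
\<close>

definition gale_vec :: "'b \<Rightarrow> real ^ 2" where
  "gale_vec x = (if x \<in> V 1 then vector [1, 1] else if x \<in> V 2 then vector [-1, 0] else vector [0, -1])"

lemma gale_vec:
  "x \<in> V 1 \<Longrightarrow> gale_vec x = vector [1, 1]" "x \<in> V 2 \<Longrightarrow> gale_vec x = vector [-1, 0]"
  "x \<in> V 3 \<Longrightarrow> gale_vec x = vector [0, -1]"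
  using disjs by (auto simp: gale_vec_def)

lemma gale_transform_gale_vec:
  assumes vs: "distinct vs" "set vs = S"
  shows "gale_transform vs (map gale_vec vs)"
proof -
  have len: "length vs = 3 * m"
  proof -
    have "card S = 3 * m"
      unfolding S_def using fins cards disjs by (simp add: card_Un_disjoint Int_Un_distrib2)
    then show ?thesis using vs distinct_card by metis
  qed
  show ?thesis
    unfolding gale_transform_def
  proof (intro conjI allI impI)
    show "int CARD(2) = int (length vs) - aff_dim (convex hull (set vs)) - 1"
      using m by (simp add: vs(2) aff_dim_convex_hull aff_dim_S len)
  next
    fix k :: 2
    have "affine_rel S (\<lambda>x. gale_vec x $ k)"
      using exhaust_2[of k]
    proof
      assume "k = 1"
      then show ?thesis by (intro rel_S'[of _ 1 "-1" 0]) (auto simp: gale_vec)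
    next
      assume "k = 2"
      then show ?thesis by (intro rel_S'[of _ 1 0 "-1"]) (auto simp: gale_vec)
    qed
    then show "affine_relation vs (\<lambda>j. map gale_vec vs ! j $ k)"
      by (subst affine_relation_nth[OF vs(1), of _ "\<lambda>x. gale_vec x $ k"]) (auto simp: vs(2))
  next
    fix t :: "2 \<Rightarrow> real" and k
    assume "\<forall>j<length vs. (\<Sum>k\<in>UNIV. t k * map gale_vec vs ! j $ k) = 0"
    then have t: "t 1 * gale_vec x $ 1 + t 2 * gale_vec x $ 2 = 0" if "x \<in> S" for x
      using that unfolding vs(2)[symmetric] in_set_conv_nth by (auto simp: sum_2)
    have "V 2 \<noteq> {}" "V 3 \<noteq> {}" using cards m by auto
    then obtain y z where yz: "y \<in> V 2" "z \<in> V 3" by blast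
    have "t 1 = 0" using t[of y] yz V_sub[of 2] by (auto simp: gale_vec)
    moreover have "t 2 = 0" using t[of z] yz V_sub[of 3] by (auto simp: gale_vec)
    ultimately show "t k = 0" using exhaust_2[of k] by auto
  next
    fix a assume a: "affine_relation vs a"
    obtain r where r: "\<And>j. j < length vs \<Longrightarrow> a j = r (vs ! j)" using ex_function_on_list[OF vs(1), of a] by blast
    then have "affine_rel S r" using affine_relation_nth[of vs a r, OF vs(1) r] a vs(2) by simp
    then obtain \<alpha> where \<alpha>: "\<alpha> 1 + \<alpha> 2 + \<alpha> 3 = 0" "\<And>i x. i \<in> {1, 2, 3} \<Longrightarrow> x \<in> V i \<Longrightarrow> r x = \<alpha> i"
      using rel_S_E by blast
    define t :: "2 \<Rightarrow> real" where "t k = (if k = 1 then - \<alpha> 2 else - \<alpha> 3)" for k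
    have "r x = t 1 * gale_vec x $ 1 + t 2 * gale_vec x $ 2" if x: "x \<in> S" for x
    proof -
      consider "x \<in> V 1" | "x \<in> V 2" | "x \<in> V 3" using x by (auto simp: S_def)
      then show ?thesis
      proof cases
        case 1
        then show ?thesis using \<alpha>(2)[of 1 x] \<alpha>(1) by (simp add: gale_vec t_def)
      next
        case 2
        then show ?thesis using \<alpha>(2)[of 2 x] by (simp add: gale_vec t_def)
      next
        case 3
        then show ?thesis using \<alpha>(2)[of 3 x] by (simp add: gale_vec t_def)
      qed
    qed
    then have "a j = (\<Sum>k\<in>UNIV. t k * map gale_vec vs ! j $ k)" if j: "j < length vs" for j
      using r[OF j] nth_mem[OF j] j unfolding vs(2) by (simp add: sum_2)
    then show "\<exists>t. \<forall>j<length vs. a j = (\<Sum>k\<in>UNIV. t k * map gale_vec vs ! j $ k)"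
      by blast
  qed simp
qed

lemma norm_vec_2: "norm (vector [x, y] :: real ^ 2) = sqrt (x\<^sup>2 + y\<^sup>2)"
  by (simp add: norm_vec_def L2_set_def sum_2)

lemma scaleR_vec_2: "c *\<^sub>R (vector [x, y] :: real ^ 2) = vector [c * x, c * y]"
  by (simp add: vec_eq_iff forall_2)

theorem gale_diagram:
  "gale_diagram_of (convex hull S)
    (replicate_mset m (vector [1 / sqrt 2, 1 / sqrt 2]) + replicate_mset m (vector [-1, 0])
      + replicate_mset m (vector [0, -1] :: real ^ 2))"
proof -
  have "\<exists>l. set l = V i \<and> distinct l" if "i \<in> {1, 2, 3}" for i
    using finite_distinct_list fin[OF that] by blast
  then obtain l where l: "\<And>i. i \<in> {1, 2, 3} \<Longrightarrow> set (l i) = V i \<and> distinct (l i)" by metis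
  let ?vs = "l 1 @ l 2 @ l 3"
  have vs: "distinct ?vs" "set ?vs = S" using l disjs by (auto simp: S_def)
  have len: "length (l i) = m" if "i \<in> {1, 2, 3}" for i
    using l[OF that] card[OF that] distinct_card by metis
  have const: "mset (map sgn (map gale_vec (l i))) = replicate_mset m (sgn c)"
    if "i \<in> {1, 2, 3}" "\<And>x. x \<in> V i \<Longrightarrow> gale_vec x = c" for i c
  proof -
    have "map sgn (map gale_vec (l i)) = replicate m (sgn c)"
      using l[OF that(1)] len[OF that(1)] that(2) by (auto intro!: replicate_eqI)
    then show ?thesis by simp
  qed
  have s: "sgn (vector [1, 1] :: real ^ 2) = vector [1 / sqrt 2, 1 / sqrt 2]"
    "sgn (vector [-1, 0] :: real ^ 2) = vector [-1, 0]" "sgn (vector [0, -1] :: real ^ 2) = vector [0, -1]"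
    by (simp_all add: sgn_div_norm norm_vec_2 scaleR_vec_2 inverse_eq_divide)
  have "mset (map sgn (map gale_vec ?vs)) = mset (map sgn (map gale_vec (l 1)))
      + mset (map sgn (map gale_vec (l 2))) + mset (map sgn (map gale_vec (l 3)))"
    by simp
  also have "\<dots> = replicate_mset m (vector [1 / sqrt 2, 1 / sqrt 2]) + replicate_mset m (vector [-1, 0])
      + replicate_mset m (vector [0, -1])"
    using const[of 1, OF _ gale_vec(1)] const[of 2, OF _ gale_vec(2)] const[of 3, OF _ gale_vec(3)] s by simp
  finally show ?thesis
    unfolding gale_diagram_of_def vertices_hull using vs gale_transform_gale_vec[OF vs] by metis
qed

end

section \<open>Face vectors of a 3-coloured polytope\<close>

context simple_3d_polytope
begin

text \<open>
  Any two of the three faces at a vertex share an edge, so they have different colours.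
\<close>

lemma colours_at_vertex:
  assumes c: "proper_coloring P c" and v: "v \<in> vertices P"
  shows "bij_betw c (star v) {1, 2, 3}"
proof -
  have inj: "inj_on c (star v)"
  proof (rule inj_onI, rule ccontr)
    fix F G assume F: "F \<in> star v" and G: "G \<in> star v" and eq: "c F = c G" and "F \<noteq> G"
    have "aff_dim (F \<inter> G) = 1" by (rule aff_dim_Int_adjacent[OF v F G \<open>F \<noteq> G\<close>])
    then show False using c F G eq \<open>F \<noteq> G\<close> unfolding proper_coloring_def star_def by blast
  qed
  have "c ` star v \<subseteq> {1, 2, 3}" using c unfolding proper_coloring_def star_def by blast
  moreover have "card (c ` star v) = card {1, 2, 3 :: nat}"
    using card_image[OF inj] card_star[OF v] by simp
  ultimately have "c ` star v = {1, 2, 3}" by (intro card_subset_eq) auto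
  then show ?thesis using inj by (simp add: bij_betw_def)
qed

text \<open>
  Record at each vertex \<open>v\<close> the coefficient \<open>f v i\<close> of its face of colour \<open>i\<close>. Along an edge two of
  the three faces stay the same, so by the zero sums at both ends the third faces have equal coefficients,
  and they have the same colour. So \<open>f\<close> is constant on the connected graph of \<open>P\<close>.
\<close>

lemma sum_star_eq_0_iff:
  fixes a :: "'a set \<Rightarrow> real"
  assumes c: "proper_coloring P c"
  shows "(\<forall>v\<in>vertices P. sum a (star v) = 0) \<longleftrightarrow>
    (\<exists>\<alpha>. \<alpha> 1 + \<alpha> 2 + \<alpha> 3 = 0 \<and> (\<forall>F\<in>two_faces P. a F = \<alpha> (c F)))"
proof
  assume "\<exists>\<alpha>. \<alpha> 1 + \<alpha> 2 + \<alpha> 3 = 0 \<and> (\<forall>F\<in>two_faces P. a F = \<alpha> (c F))"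
  then obtain \<alpha> where \<alpha>: "\<alpha> 1 + \<alpha> 2 + \<alpha> 3 = 0" "\<And>F. F \<in> two_faces P \<Longrightarrow> a F = \<alpha> (c F)" by blast
  show "\<forall>v\<in>vertices P. sum a (star v) = 0"
  proof
    fix v assume v: "v \<in> vertices P"
    have "sum a (star v) = (\<Sum>F\<in>star v. \<alpha> (c F))" using \<alpha>(2) by (intro sum.cong) (auto simp: star_def)
    also have "\<dots> = sum \<alpha> {1, 2, 3}" by (rule sum.reindex_bij_betw[OF colours_at_vertex[OF c v]])
    finally show "sum a (star v) = 0" using \<alpha>(1) by simp
  qed
next
  assume zero: "\<forall>v\<in>vertices P. sum a (star v) = 0"
  define f where "f v i = (\<Sum>F | F \<in> star v \<and> c F = i. a F)" for v i
  have f: "f v (c F) = a F" if v: "v \<in> vertices P" and F: "F \<in> star v" for v F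
  proof -
    have "{G. G \<in> star v \<and> c G = c F} = {F}"
      using colours_at_vertex[OF c v] F by (auto simp: bij_betw_def dest: inj_onD)
    then show ?thesis by (simp add: f_def)
  qed
  have f0: "f v i = 0" if v: "v \<in> vertices P" and i: "i \<notin> {1, 2, 3}" for v i
  proof -
    have "{G. G \<in> star v \<and> c G = i} = {}"
      using colours_at_vertex[OF c v] i unfolding bij_betw_def by blast
    then show ?thesis unfolding f_def by (simp only: sum.empty)
  qed
  have inv: "f (nb v F) = f v" if v: "v \<in> vertices P" and F: "F \<in> star v" for v F
  proof
    let ?w = "nb v F"
    have w: "?w \<in> vertices P" by (rule nb(1)[OF v F])
    have "card (star v - {F}) = 2" using card_star[OF v] F finite_star by simp
    then have "star v - {F} \<noteq> {}" by (metis card.empty zero_neq_numeral)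
    then obtain G where FG: "F \<noteq> G" "G \<in> star v" by blast
    obtain H where H: "star v = {F, G, H}" "H \<noteq> F" "H \<noteq> G"
      by (rule star_eq[OF v F FG(2,1)])
    have "G \<in> star ?w" "H \<in> star ?w" using nb(3)[OF v F, of G] nb(3)[OF v F, of H] H FG by (auto simp: star_def)
    then obtain K where K: "star ?w = {G, H, K}" "K \<noteq> G" "K \<noteq> H"
      by (rule star_eq[OF w _ _ H(3)[symmetric]])
    have FGH: "bij_betw c {F, G, H} {1, 2, 3}" using colours_at_vertex[OF c v] unfolding H(1) .
    have GHK: "bij_betw c {G, H, K} {1, 2, 3}" using colours_at_vertex[OF c w] unfolding K(1) .
    have imgF: "{c F, c G, c H} = {1, 2, 3}"
      using bij_betw_imp_surj_on[OF FGH] unfolding image_insert image_empty .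
    have imgK: "{c G, c H, c K} = {1, 2, 3}"
      using bij_betw_imp_surj_on[OF GHK] unfolding image_insert image_empty .
    \<comment> \<open>The third faces at both ends get the colour that the two faces along the edge leave over.\<close>
    have "c K \<noteq> c G" "c K \<noteq> c H"
      using inj_on_eq_iff[OF bij_betw_imp_inj_on[OF GHK], of K G]
        inj_on_eq_iff[OF bij_betw_imp_inj_on[OF GHK], of K H] K(2,3) by simp_all
    moreover have "c K \<in> {c F, c G, c H}" unfolding imgF imgK[symmetric] by simp
    ultimately have cK: "c K = c F" by blast
    have "sum a {F, G, H} = 0" "sum a {G, H, K} = 0"
      using bspec[OF zero v] bspec[OF zero w] unfolding H(1) K(1) .
    then have "a F + (a G + a H) = 0" "a G + (a H + a K) = 0"
      using H(2,3) FG(1) K(2,3) by simp_all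
    then have aK: "a K = a F" by simp
    fix i
    show "f ?w i = f v i"
    proof (cases "i \<in> {1, 2, 3}")
      case False
      then show ?thesis using f0[OF v] f0[OF w] by simp
    next
      case True
      then consider "i = c F" | "i = c G" | "i = c H"
        unfolding imgF[symmetric] by blast
      then show ?thesis
        using f[OF v, of F] f[OF v, of G] f[OF v, of H] f[OF w, of G] f[OF w, of H] f[OF w, of K] H(1) K(1) cK aK
        by cases auto
    qed
  qed
  obtain u where u: "u \<in> vertices P"
    using polytope_vertex_exists[OF polytope] aff_dim unfolding vertices_def by fastforce
  have const: "f v = f u" if "v \<in> vertices P" for v
    using edge_invariant_constant[of f, OF inv that u] .
  have "f u 1 + f u 2 + f u 3 = sum (f u) {1, 2, 3}" by simp
  also have "\<dots> = (\<Sum>F\<in>star u. f u (c F))"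
    by (rule sum.reindex_bij_betw[OF colours_at_vertex[OF c u], symmetric])
  also have "\<dots> = sum a (star u)" using f[OF u] by (intro sum.cong) auto
  also have "\<dots> = 0" using zero u by blast
  finally have "f u 1 + f u 2 + f u 3 = 0" .
  moreover have "a F = f u (c F)" if F: "F \<in> two_faces P" for F
  proof -
    obtain v where v: "v \<in> vertices P" "v \<in> F" using two_face_has_vertex[OF F] .
    then show ?thesis using f[OF v(1), of F] const[OF v(1)] F by (simp add: star_def)
  qed
  ultimately show "\<exists>\<alpha>. \<alpha> 1 + \<alpha> 2 + \<alpha> 3 = 0 \<and> (\<forall>F\<in>two_faces P. a F = \<alpha> (c F))" by blast
qed

context
  fixes lab :: "'v::finite \<Rightarrow> 'a"
  assumes lab: "bij_betw lab UNIV (vertices P)"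
begin

lemma inj_face_vector: "inj_on (face_vector lab :: 'a set \<Rightarrow> real ^ 'v) (two_faces P)"
proof (rule inj_onI)
  fix F G assume F: "F \<in> two_faces P" and G: "G \<in> two_faces P"
    and eq: "(face_vector lab F :: real ^ 'v) = face_vector lab G"
  have "\<forall>i. lab i \<in> F \<longleftrightarrow> lab i \<in> G"
    using eq by (simp add: face_vector_def vec_eq_iff split: if_splits) blast
  then have "vertices P \<inter> F = vertices P \<inter> G"
    unfolding bij_betw_imp_surj_on[OF lab, symmetric] by blast
  then show "F = G" using two_face_eq_hull[OF F] two_face_eq_hull[OF G] by simp
qed

lemma sum_face_vector_eq_0_iff:
  "(\<Sum>F\<in>two_faces P. a F *\<^sub>R (face_vector lab F :: real ^ 'v)) = 0 \<longleftrightarrow> (\<forall>v\<in>vertices P. sum a (star v) = 0)"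
proof -
  have "(\<Sum>F\<in>two_faces P. a F *\<^sub>R (face_vector lab F :: real ^ 'v)) $ i = sum a (star (lab i))" for i
  proof -
    have "(\<Sum>F\<in>two_faces P. a F *\<^sub>R (face_vector lab F :: real ^ 'v)) $ i
      = (\<Sum>F\<in>two_faces P. if lab i \<in> F then a F else 0)"
      by (simp add: face_vector_def if_distrib[of "(*) _"] cong: if_cong)
    also have "\<dots> = sum a (star (lab i))"
      unfolding star_def by (rule sum.inter_filter[OF finite_two_faces, symmetric])
    finally show ?thesis .
  qed
  then have "(\<Sum>F\<in>two_faces P. a F *\<^sub>R (face_vector lab F :: real ^ 'v)) = 0 \<longleftrightarrow> (\<forall>i. sum a (star (lab i)) = 0)"
    by (simp add: vec_eq_iff)
  also have "\<dots> \<longleftrightarrow> (\<forall>v\<in>vertices P. sum a (star v) = 0)"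
    using bij_betw_imp_surj_on[OF lab] by (metis UNIV_I imageE image_eqI)
  finally show ?thesis .
qed

lemma two_faces_eq_Un_colours:
  assumes "proper_coloring P c"
  shows "two_faces P = {F \<in> two_faces P. c F = 1} \<union> {F \<in> two_faces P. c F = 2} \<union> {F \<in> two_faces P. c F = 3}"
  using assms by (auto simp: proper_coloring_def)

lemma face_vectors_eq_colour_classes:
  assumes "proper_coloring P c"
  shows "face_vectors P lab = color_vectors P lab c 1 \<union> color_vectors P lab c 2 \<union> color_vectors P lab c 3"
  unfolding face_vectors_def color_vectors_def image_Un[symmetric] two_faces_eq_Un_colours[OF assms, symmetric] ..

lemma card_two_faces_colours:
  assumes "proper_coloring P c"
  shows "card (two_faces P) = color_count P c 1 + color_count P c 2 + color_count P c 3"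
proof -
  have "card ({F \<in> two_faces P. c F = 1} \<union> {F \<in> two_faces P. c F = 2} \<union> {F \<in> two_faces P. c F = 3}) = color_count P c 1 + color_count P c 2 + color_count P c 3"
    unfolding color_count_def using finite_two_faces by (subst card_Un_disjoint; auto)+
  then show ?thesis by (simp only: two_faces_eq_Un_colours[OF assms, symmetric])
qed

text \<open>
  A linear relation between face vectors is automatically affine, since the classes have the same
  size.
\<close>

lemma equal_sum_classes_colour_classes:
  assumes c: "proper_coloring P c" and m: "2 \<le> m" "\<And>i. i \<in> {1, 2, 3} \<Longrightarrow> color_count P c i = m"
  shows "equal_sum_classes (color_vectors P lab c :: nat \<Rightarrow> (real ^ 'v) set) m"
proof
  let ?\<xi> = "face_vector lab :: 'a set \<Rightarrow> real ^ 'v"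
  let ?V = "color_vectors P lab c :: nat \<Rightarrow> (real ^ 'v) set"
  show "finite (?V i)" if "i \<in> {1, 2, 3}" for i
    using finite_two_faces by (simp add: color_vectors_def)
  show "card (?V i) = m" if "i \<in> {1, 2, 3}" for i
    unfolding m(2)[OF that, symmetric] color_vectors_def color_count_def
    by (rule card_image[OF inj_on_subset[OF inj_face_vector]]) auto
  show "?V i \<inter> ?V j = {}" if "i \<in> {1, 2, 3}" "j \<in> {1, 2, 3}" "i \<noteq> j" for i j
    using inj_onD[OF inj_face_vector] that(3) unfolding color_vectors_def by blast
  show "2 \<le> m" by (rule m(1))
  fix r :: "real ^ 'v \<Rightarrow> real"
  let ?S = "?V 1 \<union> ?V 2 \<union> ?V 3"
  have S: "?S = ?\<xi> ` two_faces P" using face_vectors_eq_colour_classes[OF c] by (simp add: face_vectors_def)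
  have "(\<Sum>x\<in>?S. r x *\<^sub>R x) = (\<Sum>F\<in>two_faces P. r (?\<xi> F) *\<^sub>R ?\<xi> F)"
    unfolding S by (simp add: sum.reindex[OF inj_face_vector])
  then have by_faces: "(\<Sum>x\<in>?S. r x *\<^sub>R x) = 0 \<longleftrightarrow>
    (\<exists>\<alpha>. \<alpha> 1 + \<alpha> 2 + \<alpha> 3 = 0 \<and> (\<forall>F\<in>two_faces P. r (?\<xi> F) = \<alpha> (c F)))"
    using sum_face_vector_eq_0_iff[of "\<lambda>F. r (?\<xi> F)"] sum_star_eq_0_iff[OF c, of "\<lambda>F. r (?\<xi> F)"] by simp
  note by_faces
  also have "(\<exists>\<alpha>. \<alpha> 1 + \<alpha> 2 + \<alpha> 3 = 0 \<and> (\<forall>F\<in>two_faces P. r (?\<xi> F) = \<alpha> (c F)))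
    \<longleftrightarrow> (\<exists>\<alpha>. \<alpha> 1 + \<alpha> 2 + \<alpha> 3 = 0 \<and> (\<forall>i\<in>{1, 2, 3}. \<forall>x\<in>?V i. r x = \<alpha> i))"
  proof -
    have "(\<forall>F\<in>two_faces P. r (?\<xi> F) = \<alpha> (c F)) \<longleftrightarrow> (\<forall>i\<in>{1, 2, 3}. \<forall>x\<in>?V i. r x = \<alpha> i)" for \<alpha>
    proof
      assume R: "\<forall>i\<in>{1, 2, 3}. \<forall>x\<in>?V i. r x = \<alpha> i"
      show "\<forall>F\<in>two_faces P. r (?\<xi> F) = \<alpha> (c F)"
      proof
        fix F assume F: "F \<in> two_faces P"
        have "c F \<in> {1, 2, 3}" using c F unfolding proper_coloring_def by blast
        moreover have "?\<xi> F \<in> ?V (c F)" using F unfolding color_vectors_def by blast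
        ultimately show "r (?\<xi> F) = \<alpha> (c F)" using bspec[OF bspec[OF R]] by blast
      qed
    qed (auto simp: color_vectors_def)
    then show ?thesis by simp
  qed
  finally have iff: "(\<Sum>x\<in>?S. r x *\<^sub>R x) = 0 \<longleftrightarrow>
    (\<exists>\<alpha>. \<alpha> 1 + \<alpha> 2 + \<alpha> 3 = 0 \<and> (\<forall>i\<in>{1, 2, 3}. \<forall>x\<in>?V i. r x = \<alpha> i))" .
  have "sum r ?S = 0" if zero: "(\<Sum>x\<in>?S. r x *\<^sub>R x) = 0"
  proof -
    obtain \<alpha> where \<alpha>: "\<alpha> 1 + \<alpha> 2 + \<alpha> 3 = 0" "\<forall>F\<in>two_faces P. r (?\<xi> F) = \<alpha> (c F)"
      using zero unfolding by_faces by blast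
    have "sum r ?S = (\<Sum>F\<in>two_faces P. \<alpha> (c F))"
      unfolding S using \<alpha>(2) by (simp add: sum.reindex[OF inj_face_vector])
    also have "\<dots> = (\<Sum>i\<in>{1, 2, 3}. \<Sum>F | F \<in> two_faces P \<and> c F = i. \<alpha> (c F))"
      using finite_two_faces c by (intro sum.group[symmetric]) (auto simp: proper_coloring_def)
    also have "\<dots> = (\<Sum>i\<in>{1, 2, 3}. real m * \<alpha> i)"
      using m(2) by (intro sum.cong) (auto simp: color_count_def)
    also have "\<dots> = real m * (\<alpha> 1 + \<alpha> 2 + \<alpha> 3)" by (simp add: distrib_left)
    finally show ?thesis using \<alpha>(1) by simp
  qed
  then show "affine_rel ?S r \<longleftrightarrow>
    (\<exists>\<alpha>. \<alpha> 1 + \<alpha> 2 + \<alpha> 3 = 0 \<and> (\<forall>i\<in>{1, 2, 3}. \<forall>x\<in>?V i. r x = \<alpha> i))"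
    unfolding affine_rel_def iff[symmetric] by blast
qed

end

end

theorem proposition4p4:
  fixes P :: "'a::euclidean_space set"
    and lab :: "'v::finite \<Rightarrow> 'a"
    and c :: "'a set \<Rightarrow> nat"
    and n :: nat
  assumes "three_colorable P"
    and "card (vertices P) = 2 * n"
    and "bij_betw lab (UNIV :: 'v set) (vertices P)"
    and "proper_coloring P c"
    and "color_count P c 3 = color_count P c 2"
    and "color_count P c 2 = color_count P c 1"
    and "color_count P c 1 \<ge> 2"
  shows "vertices (face_vector_polytope P lab) = face_vectors P lab \<and>
    face_vectors P lab = color_vectors P lab c 1 \<union> color_vectors P lab c 2 \<union> color_vectors P lab c 3 \<and>
    (\<exists>D :: (real ^ 2) multiset.
      gale_diagram_of (face_vector_polytope P lab) D \<and>
      set_mset D \<subseteq> sphere 0 1 \<and>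
      D = replicate_mset (color_count P c 1) (vector [1 / sqrt 2, 1 / sqrt 2])
        + replicate_mset (color_count P c 2) (vector [-1, 0])
        + replicate_mset (color_count P c 3) (vector [0, -1])) \<and>
    (\<forall>J. J \<subset> face_vectors P lab \<longrightarrow>
      ((convex hull J) proper_face_of face_vector_polytope P lab \<longleftrightarrow>
        (\<forall>i\<in>{1, 2, 3}. \<not> color_vectors P lab c i \<subseteq> J))) \<and>
    simplicial_polytope (face_vector_polytope P lab) \<and>
    neighborly (color_count P c 2 - 1) (face_vector_polytope P lab) \<and>
    (\<exists>(w :: real ^ 'v) (Q :: (real ^ 'v) set).
      face_vector_polytope P lab = convex hull (insert w Q) \<and>
      polytope Q \<and> aff_dim Q = int n - 1 \<and>
      (\<exists>(K :: (real ^ 'v) set) (R :: (real ^ 'v) set).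
        cyclic_polytope (2 * color_count P c 2) (2 * color_count P c 2 - 2) K \<and>
        fold_pyramid (color_count P c 2 - 1) (int n - 1) K R \<and>
        comb_equiv Q R) \<and>
      {F. F facet_of Q \<and> beyond w Q F} = {F. F facet_of Q \<and> \<not> is_simplex F} \<and>
      card {F. F facet_of Q \<and> \<not> is_simplex F} = color_count P c 2 - 1)"
proof -
  interpret simple_3d_polytope P "\<lambda>v. {F \<in> two_faces P. v \<in> F}"
    by unfold_locales (use assms(1) in \<open>simp_all add: three_colorable_def\<close>)
  define m where "m = color_count P c 1"
  have counts: "color_count P c 1 = m" "color_count P c 2 = m" "color_count P c 3 = m"
    using assms(5,6) by (simp_all add: m_def)
  have m: "2 \<le> m" using assms(7) by (simp add: m_def)
  let ?V = "color_vectors P lab c :: nat \<Rightarrow> (real ^ 'v) set"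
  interpret equal_sum_classes ?V m
    using equal_sum_classes_colour_classes[OF assms(3,4) m] counts by auto
  have S: "face_vectors P lab = S"
    unfolding S_def by (rule face_vectors_eq_colour_classes[OF assms(3,4)])
  have hull: "face_vector_polytope P lab = convex hull S" by (simp add: face_vector_polytope_def S)
  have n: "n = 3 * m - 2"
    using card_two_faces card_two_faces_colours[OF assms(3,4)] assms(2) counts by simp
  have n1: "int n - 1 = 3 * int m - 3" using n m by simp
  have dim: "3 * m - 3 \<le> DIM(real ^ 'v)"
  proof -
    have "CARD('v) = 2 * n" using bij_betw_same_card[OF assms(3)] assms(2) by simp
    then show ?thesis using n m by simp
  qed
  obtain w where w: "w \<in> ?V 1" using cards m by (metis card.empty ex_in_conv not_numeral_le_zero)
  let ?Q = "convex hull (S - {w})"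
  obtain K R :: "(real ^ 'v) set" where KR: "cyclic_polytope (2 * m) (2 * m - 2) K"
    "fold_pyramid (m - 1) (3 * int m - 3) K R" "comb_equiv ?Q R"
    using pyramid_over_cyclic[OF w dim] .
  have wS: "insert w (S - {w}) = S" using w by (auto simp: S_def)
  have "convex hull S = convex hull (insert w ?Q)"
    using hull_insert[of convex w "S - {w}"] unfolding wS .
  moreover have "polytope ?Q" using finS by (intro polytope_convex_hull) auto
  moreover have "aff_dim ?Q = 3 * int m - 3" using aff_dim_S_remove[OF w] by (simp add: aff_dim_convex_hull)
  ultimately have part3: "\<exists>(w :: real ^ 'v) (Q :: (real ^ 'v) set).
      convex hull S = convex hull (insert w Q) \<and> polytope Q \<and> aff_dim Q = 3 * int m - 3 \<and>
      (\<exists>(K :: (real ^ 'v) set) (R :: (real ^ 'v) set). cyclic_polytope (2 * m) (2 * m - 2) K \<and>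
        fold_pyramid (m - 1) (3 * int m - 3) K R \<and> comb_equiv Q R) \<and>
      {F. F facet_of Q \<and> beyond w Q F} = {F. F facet_of Q \<and> \<not> is_simplex F} \<and>
      card {F. F facet_of Q \<and> \<not> is_simplex F} = m - 1"
    using KR beyond_facets[OF w] by (intro exI[of _ w] exI[of _ ?Q] conjI exI[of _ K] exI[of _ R])
  have "set_mset (replicate_mset m (vector [1 / sqrt 2, 1 / sqrt 2]) + replicate_mset m (vector [-1, 0])
      + replicate_mset m (vector [0, -1] :: real ^ 2)) \<subseteq> sphere 0 1"
    by (auto simp: norm_vec_2 power_divide split: if_splits)
  then have part1: "\<exists>D :: (real ^ 2) multiset. gale_diagram_of (convex hull S) D \<and> set_mset D \<subseteq> sphere 0 1 \<and>
      D = replicate_mset m (vector [1 / sqrt 2, 1 / sqrt 2]) + replicate_mset m (vector [-1, 0])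
        + replicate_mset m (vector [0, -1])"
    using gale_diagram by blast
  show ?thesis
    unfolding hull counts n1 S
    by (intro conjI allI impI)
      (fact vertices_hull S_def part1 part3 simplicial neighborly | erule proper_face_iff)+
qed

end
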